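(* Let $R$ be a commutative ring with $1$ and let $\mathfrak G$ be the matroid of a hyperplane arrangement on $[n]$, of rank two. For $\lambda,\eta\in R^n$ the following are equivalent: (i) $a_\lambda\wedge a_\eta=0$ in $A_R(\mathfrak G)$; (ii) $\lambda_{[n]}\eta_k-\eta_{[n]}\lambda_k=0$ for $1\le k\le n$; (iii) $\lambda_{[n]}\eta=\eta_{[n]}\lambda$. If (i)–(iii) hold, then $\lambda_{[n]}$ and $\eta_{[n]}$ each annihilate all the $2\times 2$ minors $\lambda_i\eta_j-\lambda_j\eta_i$ of the $n\times 2$ matrix $[\lambda\,|\,\eta]$.
   Context: Let $\mathcal A=\{H_1,\dots,H_n\}$ be an arrangement of distinct linear hyperplanes in $\mathbb C^\ell$ and $\mathfrak G$ its matroid on $[n]$: circuits are the minimal $C\subseteq[n]$ with $\operatorname{codim}\bigcap_{i\in C}H_i<|C|$; the rank of $\mathfrak G$ is $\operatorname{codim}\bigcap_{i=1}^nH_i$. The Orlik–Solomon algebra $A_R(\mathfrak G)$ is the quotient of the exterior algebra over $R$ on $e_1,\dots,e_n$ by the ideal generated by $\partial e_C=\sum_{k=1}^p(-1)^{k-1}e_{i_1}\wedge\cdots\widehat{e_{i_k}}\cdots\wedge e_{i_p}$ for circuits $C=\{i_1<\dots<i_p\}$; $a_i$ is the image of $e_i$ and $a_\xi=\sum_i\xi_ia_i$. For $\xi\in R^n$ and $S\subseteq[n]$, $\xi_S=\sum_{i\in S}\xi_i$. *)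

theory Defs
  imports "HOL-Analysis.Analysis" "HOL-Algebra.Module" "HOL-Algebra.QuotRing"
begin

section \<open>Hyperplane arrangements and their matroids\<close>

definition codimension :: "(complex ^ 'l) set \<Rightarrow> nat" where
  "codimension V = CARD('l) - vec.dim V"

definition linear_hyperplane :: "(complex ^ 'l) set \<Rightarrow> bool" where
  "linear_hyperplane V \<longleftrightarrow> vec.subspace V \<and> codimension V = 1"

definition hyperplane_arrangement :: "nat \<Rightarrow> (nat \<Rightarrow> (complex ^ 'l) set) \<Rightarrow> bool" where
  "hyperplane_arrangement n H \<longleftrightarrow> (\<forall>i\<in>{1..n}. linear_hyperplane (H i)) \<and> inj_on H {1..n}"

text \<open>The empty intersection is the whole space, of codimension \<open>0\<close>.\<close>

definition arrangement_dependent :: "(nat \<Rightarrow> (complex ^ 'l) set) \<Rightarrow> nat set \<Rightarrow> bool" where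
  "arrangement_dependent H C \<longleftrightarrow> codimension (\<Inter>i\<in>C. H i) < card C"

definition arrangement_circuits :: "nat \<Rightarrow> (nat \<Rightarrow> (complex ^ 'l) set) \<Rightarrow> nat set set" where
  "arrangement_circuits n H =
     {C. C \<subseteq> {1..n} \<and> arrangement_dependent H C \<and> (\<forall>D. D \<subset> C \<longrightarrow> \<not> arrangement_dependent H D)}"

definition arrangement_rank :: "nat \<Rightarrow> (nat \<Rightarrow> (complex ^ 'l) set) \<Rightarrow> nat" where
  "arrangement_rank n H = codimension (\<Inter>i\<in>{1..n}. H i)"


section \<open>The exterior algebra over \<open>R\<close> on \<open>e\<^sub>1, \<dots>, e\<^sub>n\<close>\<close>

text \<open>
  The exterior algebra is modelled as the free \<open>R\<close>-module on the subsets of \<open>{1..n}\<close>: the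
  function \<open>x\<close> stands for the sum of all \<open>x S \<cdot> e\<^sub>S\<close>, where
  \<open>e\<^sub>S = e\<^bsub>i\<^sub>1\<^esub> \<and> \<dots> \<and> e\<^bsub>i\<^sub>p\<^esub>\<close> for \<open>S = {i\<^sub>1 < \<dots> < i\<^sub>p}\<close>.  For disjoint \<open>T\<close> and \<open>U\<close>
  one has \<open>e\<^sub>T \<and> e\<^sub>U = (-1)\<^sup>m e\<^bsub>T \<union> U\<^esub>\<close>, with \<open>m\<close> the number of inversions between \<open>T\<close> and
  \<open>U\<close>; all other products of basis elements vanish.
\<close>

definition inversions :: "nat set \<Rightarrow> nat set \<Rightarrow> nat" where
  "inversions T U = card {(i, j). i \<in> T \<and> j \<in> U \<and> j < i}"

definition exterior_algebra :: "('a, 'm) ring_scheme \<Rightarrow> nat \<Rightarrow> ('a, nat set \<Rightarrow> 'a) module" where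
  "exterior_algebra R n =
     \<lparr>carrier = Pow {1..n} \<rightarrow>\<^sub>E carrier R,
      mult = (\<lambda>x y. \<lambda>S\<in>Pow {1..n}.
        (\<Oplus>\<^bsub>R\<^esub>T\<in>Pow S. (\<ominus>\<^bsub>R\<^esub> \<one>\<^bsub>R\<^esub>) [^]\<^bsub>R\<^esub> inversions T (S - T) \<otimes>\<^bsub>R\<^esub> (x T \<otimes>\<^bsub>R\<^esub> y (S - T)))),
      one = (\<lambda>S\<in>Pow {1..n}. if S = {} then \<one>\<^bsub>R\<^esub> else \<zero>\<^bsub>R\<^esub>),
      zero = (\<lambda>S\<in>Pow {1..n}. \<zero>\<^bsub>R\<^esub>),
      add = (\<lambda>x y. \<lambda>S\<in>Pow {1..n}. x S \<oplus>\<^bsub>R\<^esub> y S),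
      smult = (\<lambda>r x. \<lambda>S\<in>Pow {1..n}. r \<otimes>\<^bsub>R\<^esub> x S)\<rparr>"

definition ext_gen :: "('a, 'm) ring_scheme \<Rightarrow> nat \<Rightarrow> nat \<Rightarrow> nat set \<Rightarrow> 'a" where
  "ext_gen R n i = (\<lambda>S\<in>Pow {1..n}. if S = {i} then \<one>\<^bsub>R\<^esub> else \<zero>\<^bsub>R\<^esub>)"

definition ext_monomial :: "('a, 'm) ring_scheme \<Rightarrow> nat \<Rightarrow> nat set \<Rightarrow> nat set \<Rightarrow> 'a" where
  "ext_monomial R n S =
     foldr (\<lambda>i x. ext_gen R n i \<otimes>\<^bsub>exterior_algebra R n\<^esub> x) (sorted_list_of_set S)
       \<one>\<^bsub>exterior_algebra R n\<^esub>"

text \<open>If \<open>i\<close> is the \<open>k\<close>-th smallest element of \<open>C\<close>, then the exponent below is \<open>k - 1\<close>.\<close>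

definition ext_boundary :: "('a, 'm) ring_scheme \<Rightarrow> nat \<Rightarrow> nat set \<Rightarrow> nat set \<Rightarrow> 'a" where
  "ext_boundary R n C =
     (\<Oplus>\<^bsub>exterior_algebra R n\<^esub>i\<in>C.
        ((\<ominus>\<^bsub>R\<^esub> \<one>\<^bsub>R\<^esub>) [^]\<^bsub>R\<^esub> card {j \<in> C. j < i}) \<odot>\<^bsub>exterior_algebra R n\<^esub> ext_monomial R n (C - {i}))"


section \<open>The Orlik--Solomon algebra\<close>

text \<open>A matroid on \<open>{1..n}\<close> enters through its set of circuits \<open>\<C>\<close>.\<close>

definition OS_ideal :: "('a, 'm) ring_scheme \<Rightarrow> nat \<Rightarrow> nat set set \<Rightarrow> (nat set \<Rightarrow> 'a) set" where
  "OS_ideal R n \<C> = Idl\<^bsub>exterior_algebra R n\<^esub> (ext_boundary R n ` \<C>)"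

text \<open>
  The quotient ring \<open>Quot\<close> carries no scalar multiplication; it is added here, defined on cosets
  via representatives in the same way as \<^const>\<open>rcoset_mult\<close>.
\<close>

definition OS_algebra ::
    "('a, 'm) ring_scheme \<Rightarrow> nat \<Rightarrow> nat set set \<Rightarrow> ('a, (nat set \<Rightarrow> 'a) set) module" where
  "OS_algebra R n \<C> =
     ring.extend (exterior_algebra R n Quot OS_ideal R n \<C>)
       (module.fields (\<lambda>r X. \<Union>x\<in>X.
          OS_ideal R n \<C> +>\<^bsub>exterior_algebra R n\<^esub> (r \<odot>\<^bsub>exterior_algebra R n\<^esub> x)))"

definition OS_gen :: "('a, 'm) ring_scheme \<Rightarrow> nat \<Rightarrow> nat set set \<Rightarrow> nat \<Rightarrow> (nat set \<Rightarrow> 'a) set" where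
  "OS_gen R n \<C> i = OS_ideal R n \<C> +>\<^bsub>exterior_algebra R n\<^esub> ext_gen R n i"

definition OS_linear ::
    "('a, 'm) ring_scheme \<Rightarrow> nat \<Rightarrow> nat set set \<Rightarrow> (nat \<Rightarrow> 'a) \<Rightarrow> (nat set \<Rightarrow> 'a) set" where
  "OS_linear R n \<C> \<xi> =
     (\<Oplus>\<^bsub>OS_algebra R n \<C>\<^esub>i\<in>{1..n}. \<xi> i \<odot>\<^bsub>OS_algebra R n \<C>\<^esub> OS_gen R n \<C> i)"

definition coord_sum :: "('a, 'm) ring_scheme \<Rightarrow> (nat \<Rightarrow> 'a) \<Rightarrow> nat set \<Rightarrow> 'a" where
  "coord_sum R \<xi> S = (\<Oplus>\<^bsub>R\<^esub>i\<in>S. \<xi> i)"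


section \<open>Soundness of the model\<close>

text \<open>
  \<^const>\<open>genideal\<close> and \<^const>\<open>FactRing\<close> have their intended meaning only over a ring;
  the results below show that the model is one, and that the wedge monomials are its basis.
\<close>

lemma (in abelian_monoid) finsum_Sigma:
  assumes "finite I" "\<And>i. i \<in> I \<Longrightarrow> finite (J i)"
    and "\<And>i j. i \<in> I \<Longrightarrow> j \<in> J i \<Longrightarrow> f i j \<in> carrier G"
  shows "(\<Oplus>i\<in>I. \<Oplus>j\<in>J i. f i j) = (\<Oplus>p\<in>Sigma I J. f (fst p) (snd p))"
proof -
  have "(\<Oplus>p\<in>Sigma I J. f (fst p) (snd p)) = (\<Oplus>p\<in>(\<Union>i\<in>I. Pair i ` J i). f (fst p) (snd p))"
    by (rule arg_cong[where f="finsum G _"]) auto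
  also have "\<dots> = (\<Oplus>i\<in>I. \<Oplus>p\<in>Pair i ` J i. f (fst p) (snd p))"
    using assms by (intro add.finprod_UN_disjoint) (auto simp: pairwise_def disjnt_def)
  also have "\<dots> = (\<Oplus>i\<in>I. \<Oplus>j\<in>J i. f i j)"
  proof (intro finsum_cong' refl)
    fix i assume i: "i \<in> I"
    show "(\<Oplus>p\<in>Pair i ` J i. f (fst p) (snd p)) = (\<Oplus>j\<in>J i. f i j)"
      using assms(3)[OF i] by (subst finsum_reindex) (auto simp: inj_on_def)
  qed (use assms in \<open>auto intro!: finsum_closed\<close>)
  finally show ?thesis by simp
qed

lemma inversions_empty [simp]: "inversions {} T = 0" "inversions T {} = 0"
  by (auto simp: inversions_def)

lemma inversions_eq_card_Sigma: "inversions T U = card (Sigma T (\<lambda>i. {j \<in> U. j < i}))"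
  unfolding inversions_def by (rule arg_cong[where f=card]) auto

lemma inversions_Un_left:
  assumes "finite T" "finite T'" "finite U" "T \<inter> T' = {}"
  shows "inversions (T \<union> T') U = inversions T U + inversions T' U"
  unfolding inversions_eq_card_Sigma Sigma_Un_distrib1
  using assms by (intro card_Un_disjoint finite_SigmaI) auto

lemma inversions_Un_right:
  assumes "finite T" "finite U" "finite U'" "U \<inter> U' = {}"
  shows "inversions T (U \<union> U') = inversions T U + inversions T U'"
proof -
  have "Sigma T (\<lambda>i. {j \<in> U \<union> U'. j < i}) = Sigma T (\<lambda>i. {j \<in> U. j < i}) \<union> Sigma T (\<lambda>i. {j \<in> U'. j < i})"
    by auto
  moreover have "card (Sigma T (\<lambda>i. {j \<in> U. j < i}) \<union> Sigma T (\<lambda>i. {j \<in> U'. j < i}))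
    = card (Sigma T (\<lambda>i. {j \<in> U. j < i})) + card (Sigma T (\<lambda>i. {j \<in> U'. j < i}))"
    using assms by (intro card_Un_disjoint finite_SigmaI) auto
  ultimately show ?thesis unfolding inversions_eq_card_Sigma by (rule ssubst)
qed

lemma ext_simps:
  "carrier (exterior_algebra R n) = Pow {1..n} \<rightarrow>\<^sub>E carrier R"
  "x \<otimes>\<^bsub>exterior_algebra R n\<^esub> y = (\<lambda>S\<in>Pow {1..n}.
     (\<Oplus>\<^bsub>R\<^esub>T\<in>Pow S. (\<ominus>\<^bsub>R\<^esub> \<one>\<^bsub>R\<^esub>) [^]\<^bsub>R\<^esub> inversions T (S - T) \<otimes>\<^bsub>R\<^esub> (x T \<otimes>\<^bsub>R\<^esub> y (S - T))))"
  "\<one>\<^bsub>exterior_algebra R n\<^esub> = (\<lambda>S\<in>Pow {1..n}. if S = {} then \<one>\<^bsub>R\<^esub> else \<zero>\<^bsub>R\<^esub>)"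
  "\<zero>\<^bsub>exterior_algebra R n\<^esub> = (\<lambda>S\<in>Pow {1..n}. \<zero>\<^bsub>R\<^esub>)"
  "x \<oplus>\<^bsub>exterior_algebra R n\<^esub> y = (\<lambda>S\<in>Pow {1..n}. x S \<oplus>\<^bsub>R\<^esub> y S)"
  "r \<odot>\<^bsub>exterior_algebra R n\<^esub> x = (\<lambda>S\<in>Pow {1..n}. r \<otimes>\<^bsub>R\<^esub> x S)"
  by (simp_all add: exterior_algebra_def)

lemma ext_mult_assoc:
  assumes "cring R"
    and x: "x \<in> carrier (exterior_algebra R n)" and y: "y \<in> carrier (exterior_algebra R n)"
    and z: "z \<in> carrier (exterior_algebra R n)"
  shows "(x \<otimes>\<^bsub>exterior_algebra R n\<^esub> y) \<otimes>\<^bsub>exterior_algebra R n\<^esub> z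
    = x \<otimes>\<^bsub>exterior_algebra R n\<^esub> (y \<otimes>\<^bsub>exterior_algebra R n\<^esub> z)" (is "?L = ?R")
proof -
  interpret cring R by fact
  define sg where "sg T U = (\<ominus>\<^bsub>R\<^esub> \<one>\<^bsub>R\<^esub>) [^]\<^bsub>R\<^esub> inversions T U" for T U
  define G where "G A B C = sg A B \<otimes>\<^bsub>R\<^esub> (sg A C \<otimes>\<^bsub>R\<^esub> (sg B C \<otimes>\<^bsub>R\<^esub> (x A \<otimes>\<^bsub>R\<^esub> (y B \<otimes>\<^bsub>R\<^esub> z C))))" for A B C
  have sg: "sg T U \<in> carrier R" for T U by (simp add: sg_def)
  have mem: "x S \<in> carrier R" "y S \<in> carrier R" "z S \<in> carrier R" if "S \<subseteq> {1..n}" for S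
    using x y z that by (auto simp: ext_simps)
  have "?L S = ?R S" if S: "S \<subseteq> {1..n}" for S
  proof -
    have fin: "finite T" if "T \<subseteq> S" for T using that S by (meson finite_atLeastAtMost finite_subset)
    have mem': "x T \<in> carrier R" "y T \<in> carrier R" "z T \<in> carrier R" if "T \<subseteq> S" for T
      using mem S that by blast+
    have Gc: "G A B C \<in> carrier R" if "A \<subseteq> S" "B \<subseteq> S" "C \<subseteq> S" for A B C
      using that by (simp add: G_def sg mem')
    have sub: "T \<subseteq> {1..n}" "S - T \<subseteq> {1..n}" if "T \<subseteq> S" for T using S that by auto
    have "?L S = (\<Oplus>\<^bsub>R\<^esub>T\<in>Pow S. sg T (S - T) \<otimes>\<^bsub>R\<^esub> 
         ((\<Oplus>\<^bsub>R\<^esub>A\<in>Pow T. sg A (T - A) \<otimes>\<^bsub>R\<^esub> (x A \<otimes>\<^bsub>R\<^esub> y (T - A))) \<otimes>\<^bsub>R\<^esub> z (S - T)))"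
      using S by (simp add: ext_simps, intro finsum_cong' refl)
        (auto simp: sg_def[symmetric] sub intro!: mem' sg m_closed finsum_closed)
    also have "\<dots> = (\<Oplus>\<^bsub>R\<^esub>T\<in>Pow S. \<Oplus>\<^bsub>R\<^esub>A\<in>Pow T. G A (T - A) (S - T))"
    proof (intro finsum_cong' refl)
      fix T assume T: "T \<in> Pow S"
      have m: "sg A (T - A) \<otimes>\<^bsub>R\<^esub> (x A \<otimes>\<^bsub>R\<^esub> y (T - A)) \<in> carrier R" if "A \<in> Pow T" for A
        using that T by (intro m_closed sg mem') auto
      have "sg T (S - T) \<otimes>\<^bsub>R\<^esub> ((\<Oplus>\<^bsub>R\<^esub>A\<in>Pow T. sg A (T - A) \<otimes>\<^bsub>R\<^esub> (x A \<otimes>\<^bsub>R\<^esub> y (T - A))) \<otimes>\<^bsub>R\<^esub> z (S - T))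
         = (\<Oplus>\<^bsub>R\<^esub>A\<in>Pow T. sg T (S - T) \<otimes>\<^bsub>R\<^esub> ((sg A (T - A) \<otimes>\<^bsub>R\<^esub> (x A \<otimes>\<^bsub>R\<^esub> y (T - A))) \<otimes>\<^bsub>R\<^esub> z (S - T)))"
      proof -
        have f: "finite (Pow T)" "z (S - T) \<in> carrier R" using T fin by (auto intro!: mem')
        have "(\<Oplus>\<^bsub>R\<^esub>A\<in>Pow T. sg A (T - A) \<otimes>\<^bsub>R\<^esub> (x A \<otimes>\<^bsub>R\<^esub> y (T - A))) \<otimes>\<^bsub>R\<^esub> z (S - T)
          = (\<Oplus>\<^bsub>R\<^esub>A\<in>Pow T. (sg A (T - A) \<otimes>\<^bsub>R\<^esub> (x A \<otimes>\<^bsub>R\<^esub> y (T - A))) \<otimes>\<^bsub>R\<^esub> z (S - T))"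
          using f m by (intro finsum_ldistr) auto
        then show ?thesis
          using f m sg by (simp only:, intro finsum_rdistr) auto
      qed
      also have "\<dots> = (\<Oplus>\<^bsub>R\<^esub>A\<in>Pow T. G A (T - A) (S - T))"
      proof (intro finsum_cong' refl)
        fix A assume A: "A \<in> Pow T"
        have "inversions (A \<union> (T - A)) (S - T) = inversions A (S - T) + inversions (T - A) (S - T)"
          using A T by (intro inversions_Un_left fin) auto
        moreover have "A \<union> (T - A) = T" using A by auto
        ultimately have e: "sg T (S - T) = sg A (S - T) \<otimes>\<^bsub>R\<^esub> sg (T - A) (S - T)"
          by (simp add: sg_def nat_pow_mult)
        have "x A \<in> carrier R" "y (T - A) \<in> carrier R" "z (S - T) \<in> carrier R"
          using A T by (auto intro!: mem')
        then show "sg T (S - T) \<otimes>\<^bsub>R\<^esub> ((sg A (T - A) \<otimes>\<^bsub>R\<^esub> (x A \<otimes>\<^bsub>R\<^esub> y (T - A))) \<otimes>\<^bsub>R\<^esub> z (S - T)) = G A (T - A) (S - T)"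
          unfolding G_def e using sg by (simp add: m_ac)
      qed (use T in \<open>auto intro!: Gc\<close>)
      finally show "sg T (S - T) \<otimes>\<^bsub>R\<^esub> ((\<Oplus>\<^bsub>R\<^esub>A\<in>Pow T. sg A (T - A) \<otimes>\<^bsub>R\<^esub> (x A \<otimes>\<^bsub>R\<^esub> y (T - A))) \<otimes>\<^bsub>R\<^esub> z (S - T))
         = (\<Oplus>\<^bsub>R\<^esub>A\<in>Pow T. G A (T - A) (S - T))" .
    qed (auto intro!: finsum_closed Gc)
    also have "\<dots> = (\<Oplus>\<^bsub>R\<^esub>p\<in>Sigma (Pow S) Pow. G (snd p) (fst p - snd p) (S - fst p))"
      by (rule finsum_Sigma) (auto simp: fin intro!: Gc)
    also have "Sigma (Pow S) Pow = (\<lambda>p. (fst p \<union> snd p, fst p)) ` Sigma (Pow S) (\<lambda>A. Pow (S - A))"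
    proof (intro equalityI subsetI)
      fix p assume "p \<in> Sigma (Pow S) Pow"
      then show "p \<in> (\<lambda>p. (fst p \<union> snd p, fst p)) ` Sigma (Pow S) (\<lambda>A. Pow (S - A))"
        by (intro image_eqI[where x="(snd p, fst p - snd p)"]) auto
    qed auto
    also have "(\<Oplus>\<^bsub>R\<^esub>p\<in>\<dots>. G (snd p) (fst p - snd p) (S - fst p))
      = (\<Oplus>\<^bsub>R\<^esub>p\<in>Sigma (Pow S) (\<lambda>A. Pow (S - A)). G (fst p) ((fst p \<union> snd p) - fst p) (S - (fst p \<union> snd p)))"
    proof (subst finsum_reindex)
      show "inj_on (\<lambda>p. (fst p \<union> snd p, fst p)) (Sigma (Pow S) (\<lambda>A. Pow (S - A)))"
        by (rule inj_on_inverseI[where g="\<lambda>q. (snd q, fst q - snd q)"]) auto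
    qed (auto intro!: Gc)
    also have "\<dots> = (\<Oplus>\<^bsub>R\<^esub>p\<in>Sigma (Pow S) (\<lambda>A. Pow (S - A)). G (fst p) (snd p) (S - fst p - snd p))"
    proof (intro finsum_cong' refl)
      fix p assume "p \<in> Sigma (Pow S) (\<lambda>A. Pow (S - A))"
      then have "(fst p \<union> snd p) - fst p = snd p" "S - (fst p \<union> snd p) = S - fst p - snd p" by auto
      then show "G (fst p) ((fst p \<union> snd p) - fst p) (S - (fst p \<union> snd p)) = G (fst p) (snd p) (S - fst p - snd p)"
        by simp
    qed (auto intro!: Gc)
    also have "\<dots> = (\<Oplus>\<^bsub>R\<^esub>A\<in>Pow S. \<Oplus>\<^bsub>R\<^esub>B\<in>Pow (S - A). G A B (S - A - B))"
      by (rule finsum_Sigma[symmetric]) (auto simp: fin intro!: Gc)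
    also have "\<dots> = (\<Oplus>\<^bsub>R\<^esub>A\<in>Pow S. sg A (S - A) \<otimes>\<^bsub>R\<^esub> (x A \<otimes>\<^bsub>R\<^esub> 
         (\<Oplus>\<^bsub>R\<^esub>B\<in>Pow (S - A). sg B (S - A - B) \<otimes>\<^bsub>R\<^esub> (y B \<otimes>\<^bsub>R\<^esub> z (S - A - B)))))"
    proof (intro finsum_cong' refl)
      fix A assume A: "A \<in> Pow S"
      have m: "sg B (S - A - B) \<otimes>\<^bsub>R\<^esub> (y B \<otimes>\<^bsub>R\<^esub> z (S - A - B)) \<in> carrier R" if "B \<in> Pow (S - A)" for B
        using that A by (intro m_closed sg mem') auto
      have "sg A (S - A) \<otimes>\<^bsub>R\<^esub> (x A \<otimes>\<^bsub>R\<^esub> 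
         (\<Oplus>\<^bsub>R\<^esub>B\<in>Pow (S - A). sg B (S - A - B) \<otimes>\<^bsub>R\<^esub> (y B \<otimes>\<^bsub>R\<^esub> z (S - A - B))))
         = (\<Oplus>\<^bsub>R\<^esub>B\<in>Pow (S - A). sg A (S - A) \<otimes>\<^bsub>R\<^esub> (x A \<otimes>\<^bsub>R\<^esub> (sg B (S - A - B) \<otimes>\<^bsub>R\<^esub> (y B \<otimes>\<^bsub>R\<^esub> z (S - A - B)))))"
      proof -
        have f: "finite (Pow (S - A))" "x A \<in> carrier R" using A fin by (auto intro!: mem')
        have "x A \<otimes>\<^bsub>R\<^esub> (\<Oplus>\<^bsub>R\<^esub>B\<in>Pow (S - A). sg B (S - A - B) \<otimes>\<^bsub>R\<^esub> (y B \<otimes>\<^bsub>R\<^esub> z (S - A - B)))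
          = (\<Oplus>\<^bsub>R\<^esub>B\<in>Pow (S - A). x A \<otimes>\<^bsub>R\<^esub> (sg B (S - A - B) \<otimes>\<^bsub>R\<^esub> (y B \<otimes>\<^bsub>R\<^esub> z (S - A - B))))"
          using f m by (intro finsum_rdistr) auto
        then show ?thesis
          using f m sg by (simp only:, intro finsum_rdistr) auto
      qed
      also have "\<dots> = (\<Oplus>\<^bsub>R\<^esub>B\<in>Pow (S - A). G A B (S - A - B))"
      proof (intro finsum_cong' refl)
        fix B assume B: "B \<in> Pow (S - A)"
        have "inversions A (B \<union> (S - A - B)) = inversions A B + inversions A (S - A - B)"
          using A B by (intro inversions_Un_right fin) auto
        moreover have "B \<union> (S - A - B) = S - A" using B by auto
        ultimately have e: "sg A (S - A) = sg A B \<otimes>\<^bsub>R\<^esub> sg A (S - A - B)"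
          by (simp add: sg_def nat_pow_mult)
        have "x A \<in> carrier R" "y B \<in> carrier R" "z (S - A - B) \<in> carrier R"
          using A B by (auto intro!: mem')
        then show "sg A (S - A) \<otimes>\<^bsub>R\<^esub> (x A \<otimes>\<^bsub>R\<^esub> (sg B (S - A - B) \<otimes>\<^bsub>R\<^esub> (y B \<otimes>\<^bsub>R\<^esub> z (S - A - B)))) = G A B (S - A - B)"
          unfolding G_def e using sg by (simp add: m_ac)
      qed (use A in \<open>auto intro!: Gc\<close>)
      finally show "(\<Oplus>\<^bsub>R\<^esub>B\<in>Pow (S - A). G A B (S - A - B)) = sg A (S - A) \<otimes>\<^bsub>R\<^esub> (x A \<otimes>\<^bsub>R\<^esub> 
         (\<Oplus>\<^bsub>R\<^esub>B\<in>Pow (S - A). sg B (S - A - B) \<otimes>\<^bsub>R\<^esub> (y B \<otimes>\<^bsub>R\<^esub> z (S - A - B))))" by simp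
    qed (auto intro!: finsum_closed m_closed sg mem')
    also have "\<dots> = ?R S"
      using S by (simp add: ext_simps, intro finsum_cong' refl)
        (auto simp: sg_def[symmetric] sub intro!: mem' sg m_closed finsum_closed)
    finally show ?thesis .
  qed
  moreover have "?L S = ?R S" if "\<not> S \<subseteq> {1..n}" for S
    using that by (simp add: ext_simps)
  ultimately show ?thesis by blast
qed

lemma ext_one_mult:
  assumes "cring R" and x: "x \<in> carrier (exterior_algebra R n)"
  shows "\<one>\<^bsub>exterior_algebra R n\<^esub> \<otimes>\<^bsub>exterior_algebra R n\<^esub> x = x"
    and "x \<otimes>\<^bsub>exterior_algebra R n\<^esub> \<one>\<^bsub>exterior_algebra R n\<^esub> = x"
proof -
  interpret cring R by fact
  have x': "x S \<in> carrier R" if "S \<subseteq> {1..n}" for S using x that by (auto simp: ext_simps)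
  have x'': "x (S - T) \<in> carrier R" if "S \<subseteq> {1..n}" for S T using that by (intro x') auto
  have und: "x S = undefined" if "\<not> S \<subseteq> {1..n}" for S using x that by (auto simp: ext_simps)
  have "(\<one>\<^bsub>exterior_algebra R n\<^esub> \<otimes>\<^bsub>exterior_algebra R n\<^esub> x) S = x S" if S: "S \<subseteq> {1..n}" for S
  proof -
    have "finite S" using S finite_subset by blast
    have sub: "T \<subseteq> {1..n}" "S - T \<subseteq> {1..n}" "x T \<in> carrier R" "x (S - T) \<in> carrier R"
      if "T \<subseteq> S" for T using S that by (auto intro!: x')
    have "(\<one>\<^bsub>exterior_algebra R n\<^esub> \<otimes>\<^bsub>exterior_algebra R n\<^esub> x) S
       = (\<Oplus>\<^bsub>R\<^esub>T\<in>Pow S. if {} = T then x (S - T) else \<zero>\<^bsub>R\<^esub>)"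
      using S by (simp add: ext_simps, intro finsum_cong' refl) (auto simp: sub)
    also have "\<dots> = x (S - {})"
      by (rule finsum_singleton) (use S \<open>finite S\<close> in \<open>auto intro!: x'\<close>)
    finally show ?thesis by simp
  qed
  moreover have "(x \<otimes>\<^bsub>exterior_algebra R n\<^esub> \<one>\<^bsub>exterior_algebra R n\<^esub>) S = x S" if S: "S \<subseteq> {1..n}" for S
  proof -
    have "finite S" using S finite_subset by blast
    have sub: "T \<subseteq> {1..n}" "S - T \<subseteq> {1..n}" "x T \<in> carrier R" "x (S - T) \<in> carrier R"
      if "T \<subseteq> S" for T using S that by (auto intro!: x')
    have "(x \<otimes>\<^bsub>exterior_algebra R n\<^esub> \<one>\<^bsub>exterior_algebra R n\<^esub>) S
       = (\<Oplus>\<^bsub>R\<^esub>T\<in>Pow S. if S = T then x T else \<zero>\<^bsub>R\<^esub>)"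
      using S by (simp add: ext_simps, intro finsum_cong' refl) (auto simp: sub)
    also have "\<dots> = x S"
      by (rule finsum_singleton) (use S \<open>finite S\<close> in \<open>auto intro!: x'\<close>)
    finally show ?thesis by simp
  qed
  moreover have "(\<one>\<^bsub>exterior_algebra R n\<^esub> \<otimes>\<^bsub>exterior_algebra R n\<^esub> x) S = x S"
    "(x \<otimes>\<^bsub>exterior_algebra R n\<^esub> \<one>\<^bsub>exterior_algebra R n\<^esub>) S = x S" if "\<not> S \<subseteq> {1..n}" for S
    using und[OF that] that by (simp_all add: ext_simps)
  ultimately show "\<one>\<^bsub>exterior_algebra R n\<^esub> \<otimes>\<^bsub>exterior_algebra R n\<^esub> x = x"
    and "x \<otimes>\<^bsub>exterior_algebra R n\<^esub> \<one>\<^bsub>exterior_algebra R n\<^esub> = x"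
    by blast+
qed

theorem ring_exterior_algebra:
  assumes "cring R"
  shows "ring (exterior_algebra R n)"
proof -
  interpret cring R by fact
  have mem: "x S \<in> carrier R" if "x \<in> carrier (exterior_algebra R n)" "S \<subseteq> {1..n}" for x S
    using that by (auto simp: ext_simps)
  have memD: "x (S - T) \<in> carrier R" if "x \<in> carrier (exterior_algebra R n)" "S \<subseteq> {1..n}" for x S T
    using that by (intro mem) auto
  have memS: "x T \<in> carrier R" if "x \<in> carrier (exterior_algebra R n)" "S \<subseteq> {1..n}" "T \<subseteq> S" for x S T
    using that by (intro mem) auto
  have eqI: "x = y" if "x \<in> carrier (exterior_algebra R n)" "y \<in> carrier (exterior_algebra R n)"
     "\<And>S. S \<subseteq> {1..n} \<Longrightarrow> x S = y S" for x y
    using that unfolding ext_simps by (rule PiE_ext) simp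
  have add_closed: "x \<oplus>\<^bsub>exterior_algebra R n\<^esub> y \<in> carrier (exterior_algebra R n)"
    if "x \<in> carrier (exterior_algebra R n)" "y \<in> carrier (exterior_algebra R n)" for x y
    using that by (auto simp: ext_simps)
  have mult_closed: "x \<otimes>\<^bsub>exterior_algebra R n\<^esub> y \<in> carrier (exterior_algebra R n)"
    if "x \<in> carrier (exterior_algebra R n)" "y \<in> carrier (exterior_algebra R n)" for x y
    using memD[OF that(2)] memS[OF that(1)] by (auto simp: ext_simps intro!: finsum_closed m_closed)
  show ?thesis
  proof (rule ringI)
    show "abelian_group (exterior_algebra R n)"
    proof (rule abelian_groupI)
      fix x assume x: "x \<in> carrier (exterior_algebra R n)"
      show "\<exists>y\<in>carrier (exterior_algebra R n). y \<oplus>\<^bsub>exterior_algebra R n\<^esub> x = \<zero>\<^bsub>exterior_algebra R n\<^esub>"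
        using mem[OF x] by (intro bexI[where x="\<lambda>S\<in>Pow {1..n}. \<ominus>\<^bsub>R\<^esub> x S"])
          (auto simp: ext_simps l_neg intro!: restrict_ext)
    qed (auto intro!: eqI add_closed, auto simp: ext_simps mem a_ac PiE_mem)
    show "monoid (exterior_algebra R n)"
      by (rule monoidI) (auto simp: mult_closed ext_mult_assoc[OF assms] ext_one_mult[OF assms], auto simp: ext_simps)
    fix x y z assume xyz: "x \<in> carrier (exterior_algebra R n)" "y \<in> carrier (exterior_algebra R n)" "z \<in> carrier (exterior_algebra R n)"
    note c = memS[OF xyz(1)] memS[OF xyz(2)] memS[OF xyz(3)] memD[OF xyz(1)] memD[OF xyz(2)] memD[OF xyz(3)]
    show "(x \<oplus>\<^bsub>exterior_algebra R n\<^esub> y) \<otimes>\<^bsub>exterior_algebra R n\<^esub> z =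
       x \<otimes>\<^bsub>exterior_algebra R n\<^esub> z \<oplus>\<^bsub>exterior_algebra R n\<^esub> y \<otimes>\<^bsub>exterior_algebra R n\<^esub> z"
    proof (rule eqI)
      fix S assume S: "S \<subseteq> {1..n}"
      have sub: "T \<subseteq> {1..n}" if "T \<subseteq> S" for T using that S by blast
      show "((x \<oplus>\<^bsub>exterior_algebra R n\<^esub> y) \<otimes>\<^bsub>exterior_algebra R n\<^esub> z) S =
       (x \<otimes>\<^bsub>exterior_algebra R n\<^esub> z \<oplus>\<^bsub>exterior_algebra R n\<^esub> y \<otimes>\<^bsub>exterior_algebra R n\<^esub> z) S"
        using S c[OF S]
        by (simp add: ext_simps, intro trans[OF _ finsum_addf] finsum_cong' refl)
          (auto simp: sub l_distr r_distr)
    qed (use xyz in \<open>auto intro!: add_closed mult_closed\<close>)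
    show "z \<otimes>\<^bsub>exterior_algebra R n\<^esub> (x \<oplus>\<^bsub>exterior_algebra R n\<^esub> y) =
       z \<otimes>\<^bsub>exterior_algebra R n\<^esub> x \<oplus>\<^bsub>exterior_algebra R n\<^esub> z \<otimes>\<^bsub>exterior_algebra R n\<^esub> y"
    proof (rule eqI)
      fix S assume S: "S \<subseteq> {1..n}"
      have sub: "S - T \<subseteq> {1..n}" for T using S by blast
      show "(z \<otimes>\<^bsub>exterior_algebra R n\<^esub> (x \<oplus>\<^bsub>exterior_algebra R n\<^esub> y)) S =
       (z \<otimes>\<^bsub>exterior_algebra R n\<^esub> x \<oplus>\<^bsub>exterior_algebra R n\<^esub> z \<otimes>\<^bsub>exterior_algebra R n\<^esub> y) S"
        using S c[OF S]
        by (simp add: ext_simps, intro trans[OF _ finsum_addf] finsum_cong' refl)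
          (auto simp: sub l_distr r_distr)
    qed (use xyz in \<open>auto intro!: add_closed mult_closed\<close>)
  qed
qed

lemma ext_gen_mult_basis:
  assumes "cring R" and i: "i \<in> {1..n}" "\<forall>j\<in>T. i < j" and T: "T \<subseteq> {1..n}"
  shows "ext_gen R n i \<otimes>\<^bsub>exterior_algebra R n\<^esub> (\<lambda>S\<in>Pow {1..n}. if S = T then \<one>\<^bsub>R\<^esub> else \<zero>\<^bsub>R\<^esub>)
    = (\<lambda>S\<in>Pow {1..n}. if S = insert i T then \<one>\<^bsub>R\<^esub> else \<zero>\<^bsub>R\<^esub>)" (is "?L = ?R")
proof
  interpret cring R by fact
  have inv: "inversions {i} T = 0"
  proof -
    have "Sigma {i} (\<lambda>k. {j \<in> T. j < k}) = {}"
      using i(2) by (auto dest: order.asym)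
    then show ?thesis unfolding inversions_eq_card_Sigma by (simp only: card.empty)
  qed
  have T': "insert i T - {i} = T" "insert i T \<subseteq> {1..n}"
    using i T by auto
  fix S
  show "?L S = ?R S"
  proof (cases "S \<subseteq> {1..n}")
    case S: True
    then have sub: "U \<subseteq> {1..n}" "S - U \<subseteq> {1..n}" if "U \<subseteq> S" for U
      using that by auto
    have "finite S" using S finite_subset by blast
    have "?L S = (\<Oplus>\<^bsub>R\<^esub>U\<in>Pow S. (\<ominus>\<^bsub>R\<^esub> \<one>\<^bsub>R\<^esub>) [^]\<^bsub>R\<^esub> inversions U (S - U) \<otimes>\<^bsub>R\<^esub>
        (ext_gen R n i U \<otimes>\<^bsub>R\<^esub> (\<lambda>S\<in>Pow {1..n}. if S = T then \<one>\<^bsub>R\<^esub> else \<zero>\<^bsub>R\<^esub>) (S - U)))"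
      unfolding ext_simps(2) by (subst restrict_apply', use S in simp, rule refl)
    also have "\<dots> = (\<Oplus>\<^bsub>R\<^esub>U\<in>Pow S. if U = {i} \<and> S = insert i T then \<one>\<^bsub>R\<^esub> else \<zero>\<^bsub>R\<^esub>)"
    proof (intro finsum_cong' refl)
      fix U assume U: "U \<in> Pow S"
      have mem: "U \<in> Pow {1..n}" "S - U \<in> Pow {1..n}" using U sub by auto
      have gen: "ext_gen R n i U = (if U = {i} then \<one>\<^bsub>R\<^esub> else \<zero>\<^bsub>R\<^esub>)"
        and basis: "(\<lambda>S\<in>Pow {1..n}. if S = T then \<one>\<^bsub>R\<^esub> else \<zero>\<^bsub>R\<^esub>) (S - U) = (if S - U = T then \<one>\<^bsub>R\<^esub> else \<zero>\<^bsub>R\<^esub>)"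
        unfolding ext_gen_def by (simp_all only: restrict_apply'[OF mem(1)] restrict_apply'[OF mem(2)])
      show "(\<ominus>\<^bsub>R\<^esub> \<one>\<^bsub>R\<^esub>) [^]\<^bsub>R\<^esub> inversions U (S - U) \<otimes>\<^bsub>R\<^esub>
          (ext_gen R n i U \<otimes>\<^bsub>R\<^esub> (\<lambda>S\<in>Pow {1..n}. if S = T then \<one>\<^bsub>R\<^esub> else \<zero>\<^bsub>R\<^esub>) (S - U))
          = (if U = {i} \<and> S = insert i T then \<one>\<^bsub>R\<^esub> else \<zero>\<^bsub>R\<^esub>)"
      proof (cases "U = {i}")
        case True
        show ?thesis
        proof (cases "S = insert i T")
          case True
          then show ?thesis unfolding gen basis using \<open>U = {i}\<close> T'(1) inv by simp
        next
          case False
          moreover have "S - U \<noteq> T" using False True U by blast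
          ultimately show ?thesis unfolding gen basis by (simp only: if_False if_True) simp
        qed
      qed (use mem in \<open>simp add: gen basis\<close>)
    qed auto
    also have "\<dots> = ?R S"
    proof (cases "S = insert i T")
      case True
      have "(\<Oplus>\<^bsub>R\<^esub>U\<in>Pow S. if {i} = U then \<one>\<^bsub>R\<^esub> else \<zero>\<^bsub>R\<^esub>) = \<one>\<^bsub>R\<^esub>"
        by (rule finsum_singleton) (use True \<open>finite S\<close> in auto)
      moreover have "(\<Oplus>\<^bsub>R\<^esub>U\<in>Pow S. if U = {i} \<and> S = insert i T then \<one>\<^bsub>R\<^esub> else \<zero>\<^bsub>R\<^esub>)
          = (\<Oplus>\<^bsub>R\<^esub>U\<in>Pow S. if {i} = U then \<one>\<^bsub>R\<^esub> else \<zero>\<^bsub>R\<^esub>)"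
        using True by (intro finsum_cong') auto
      ultimately show ?thesis using True S by simp
    next
      case False
      then show ?thesis using S by (simp add: finsum_zero)
    qed
    finally show ?thesis .
  qed (simp add: ext_simps)
qed

lemma ext_monomial_eq_basis:
  assumes "cring R" and S: "S \<subseteq> {1..n}"
  shows "ext_monomial R n S = (\<lambda>T\<in>Pow {1..n}. if T = S then \<one>\<^bsub>R\<^esub> else \<zero>\<^bsub>R\<^esub>)"
proof -
  have "foldr (\<lambda>i x. ext_gen R n i \<otimes>\<^bsub>exterior_algebra R n\<^esub> x) xs \<one>\<^bsub>exterior_algebra R n\<^esub>
      = (\<lambda>T\<in>Pow {1..n}. if T = set xs then \<one>\<^bsub>R\<^esub> else \<zero>\<^bsub>R\<^esub>)"
    if "sorted xs" "distinct xs" "set xs \<subseteq> {1..n}" for xs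
    using that
  proof (induction xs)
    case Nil
    then show ?case by (simp add: ext_simps)
  next
    case (Cons i xs)
    then have lt: "\<forall>j\<in>set xs. i < j"
      by (auto simp: order.strict_iff_order)
    have IH: "foldr (\<lambda>i x. ext_gen R n i \<otimes>\<^bsub>exterior_algebra R n\<^esub> x) xs \<one>\<^bsub>exterior_algebra R n\<^esub>
      = (\<lambda>T\<in>Pow {1..n}. if T = set xs then \<one>\<^bsub>R\<^esub> else \<zero>\<^bsub>R\<^esub>)"
      using Cons by auto
    have "ext_gen R n i \<otimes>\<^bsub>exterior_algebra R n\<^esub> (\<lambda>T\<in>Pow {1..n}. if T = set xs then \<one>\<^bsub>R\<^esub> else \<zero>\<^bsub>R\<^esub>)
      = (\<lambda>T\<in>Pow {1..n}. if T = insert i (set xs) then \<one>\<^bsub>R\<^esub> else \<zero>\<^bsub>R\<^esub>)"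
      using Cons.prems lt by (intro ext_gen_mult_basis assms(1)) auto
    then show ?case
      by (simp only: foldr.simps o_apply IH list.set)
  qed
  moreover have "finite S" using S finite_subset by blast
  ultimately show ?thesis
    using S by (simp add: ext_monomial_def)
qed

end

theory Submission
  imports Defs "HOL-Algebra.Multiplicative_Group"
begin

text \<open>
  In rank two the circuits are exactly the triples.  Let \<open>\<partial>\<close> be the derivation with \<open>\<partial>e\<^sub>i = 1\<close>.
  The elements without terms of degree below two whose degree two part is killed by \<open>\<partial>\<close> form an
  ideal containing every \<open>\<partial>e\<^sub>C\<close>, and \<open>\<partial>(\<lambda> \<and> \<eta>) = \<lambda>\<^bsub>[n]\<^esub> \<eta> - \<eta>\<^bsub>[n]\<^esub> \<lambda>\<close>; so (i) implies (ii).  Conversely,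
  the products \<open>(e\<^sub>i - e\<^sub>1) \<and> (e\<^sub>j - e\<^sub>1)\<close> lie in the Orlik--Solomon ideal, hence so does
  \<open>(\<lambda> - \<lambda>\<^bsub>[n]\<^esub> e\<^sub>1) \<and> (\<eta> - \<eta>\<^bsub>[n]\<^esub> e\<^sub>1) = \<lambda> \<and> \<eta> - e\<^sub>1 \<and> (\<lambda>\<^bsub>[n]\<^esub> \<eta> - \<eta>\<^bsub>[n]\<^esub> \<lambda>)\<close>.
\<close>

section \<open>Circuits of a rank two arrangement\<close>

text \<open>Every partial intersection contains the total one and so has codimension at most 2,
  while two distinct hyperplanes already meet in codimension at least 2. Hence dependence of a
  subset is decided by its size alone: three elements are needed and suffice.\<close>

lemma arrangement_circuits_rank_two:
  fixes H :: "nat \<Rightarrow> (complex ^ 'l) set"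
  assumes arr: "hyperplane_arrangement n H" and rank: "arrangement_rank n H = 2"
  shows "arrangement_circuits n H = {C. C \<subseteq> {1..n} \<and> card C = 3}"
proof -
  have hyp: "vec.subspace (H i)" "codimension (H i) = 1" if "i \<in> {1..n}" for i
    using arr that by (auto simp: hyperplane_arrangement_def linear_hyperplane_def)
  have dim_le: "vec.dim V \<le> CARD('l)" for V :: "(complex ^ 'l) set"
    by (metis vec.dim_subset subset_UNIV vec_dim_card)
  have upper: "codimension (\<Inter>i\<in>D. H i) \<le> 2" if "D \<subseteq> {1..n}" for D
  proof -
    have "vec.dim (\<Inter>i\<in>{1..n}. H i) \<le> vec.dim (\<Inter>i\<in>D. H i)"
      using that by (intro vec.dim_subset) auto
    then show ?thesis using rank by (auto simp: arrangement_rank_def codimension_def)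
  qed
  have lower: "card D \<le> codimension (\<Inter>i\<in>D. H i)" if D: "D \<subseteq> {1..n}" "card D \<le> 2" for D
  proof -
    have "finite D" using D finite_subset by blast
    consider "card D = 0" | "card D = 1" | "card D = 2" using D(2) by linarith
    then show ?thesis
    proof cases
      case 2
      then obtain i where "D = {i}" by (auto simp: card_1_singleton_iff)
      then show ?thesis using hyp(2)[of i] D(1) by simp
    next
      case 3
      then obtain i j where ij: "D = {i, j}" "i \<noteq> j" by (auto simp: card_2_iff)
      have i: "i \<in> {1..n}" and j: "j \<in> {1..n}" using ij(1) D(1) by auto
      have ne: "H i \<noteq> H j"
        using arr ij(2) i j inj_onD[of H "{1..n}" i j] by (simp only: hyperplane_arrangement_def) blast
      \<comment> \<open>If the dimension did not drop, the intersection would be all of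
        \<open>H i\<close>; since \<open>H j\<close> has the same dimension, it would also be all of
        \<open>H j\<close>, contradicting distinctness.\<close>
      have "vec.dim (H i \<inter> H j) < vec.dim (H i)"
      proof (rule ccontr)
        assume "\<not> ?thesis"
        then have d: "vec.dim (H i) \<le> vec.dim (H i \<inter> H j)" by simp
        have "vec.dim (H j) = vec.dim (H i)"
          using hyp(2)[OF i] hyp(2)[OF j] by (simp add: codimension_def)
        then have d': "vec.dim (H j) \<le> vec.dim (H i \<inter> H j)" using d by simp
        have s: "vec.subspace (H i \<inter> H j)" using hyp(1)[OF i] hyp(1)[OF j] by (rule vec.subspace_inter)
        have "H i \<inter> H j = H i" by (rule vec.subspace_dim_equal[OF s hyp(1)[OF i] _ d]) simp
        moreover have "H i \<inter> H j = H j" by (rule vec.subspace_dim_equal[OF s hyp(1)[OF j] _ d']) simp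
        ultimately show False using ne by simp
      qed
      then have "2 \<le> codimension (H i \<inter> H j)"
        using hyp(2)[OF i] dim_le[of "H i"] by (simp add: codimension_def)
      then show ?thesis using ij 3 by simp
    qed simp
  qed
  have dep: "arrangement_dependent H D \<longleftrightarrow> 3 \<le> card D" if "D \<subseteq> {1..n}" for D
    using upper[OF that] lower[OF that] by (cases "card D \<le> 2") (auto simp: arrangement_dependent_def)
  show ?thesis
  proof (intro equalityI subsetI)
    fix C assume "C \<in> arrangement_circuits n H"
    then have C: "C \<subseteq> {1..n}" "3 \<le> card C" and min: "\<And>D. D \<subset> C \<Longrightarrow> \<not> 3 \<le> card D"
      using dep by (auto simp: arrangement_circuits_def)
    obtain D where D: "D \<subseteq> C" "card D = 3"
      using C(2) by (metis obtain_subset_with_card_n)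
    then show "C \<in> {C. C \<subseteq> {1..n} \<and> card C = 3}"
      using min[of D] C by auto
  next
    fix C assume C: "C \<in> {C. C \<subseteq> {1..n} \<and> card C = 3}"
    then have "finite C" by (auto intro: finite_subset)
    have "\<not> arrangement_dependent H D" if "D \<subset> C" for D
      using psubset_card_mono[OF \<open>finite C\<close> that] C that dep[of D] by auto
    then show "C \<in> arrangement_circuits n H"
      using C dep[of C] by (simp add: arrangement_circuits_def)
  qed
qed

text \<open>The signs in a boundary depend on the order of the elements, so a triple has to be
  presented increasingly before its boundary is computed.\<close>

lemma card_3_orderedE:
  fixes C :: "nat set"
  assumes "card C = 3"
  obtains a b c where "a < b" "b < c" "C = {a, b, c}"
proof -
  obtain x y z where xyz: "C = {x, y, z}" "x \<noteq> y" "y \<noteq> z" "x \<noteq> z"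
    using assms by (auto simp: card_3_iff)
  consider "x < y" "y < z" | "x < z" "z < y" | "y < x" "x < z" | "y < z" "z < x" | "z < x" "x < y" | "z < y" "y < x"
    using xyz by linarith
  then show thesis
    by cases (use xyz that in \<open>blast+\<close>)
qed

section \<open>Scalars, sums and ideals in the exterior algebra\<close>

locale exterior = cring R for R (structure) + fixes n :: nat
begin

abbreviation "E \<equiv> exterior_algebra R n"

sublocale E: ring E
  by (rule ring_exterior_algebra) (rule is_cring)

lemma ext_mem: "x \<in> carrier E \<Longrightarrow> S \<subseteq> {1..n} \<Longrightarrow> x S \<in> carrier R"
  by (auto simp: ext_simps)

lemma ext_apply:
  assumes "S \<subseteq> {1..n}"
  shows "\<zero>\<^bsub>E\<^esub> S = \<zero>" "(x \<oplus>\<^bsub>E\<^esub> y) S = x S \<oplus> y S" "(r \<odot>\<^bsub>E\<^esub> x) S = r \<otimes> x S"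
  using assms by (simp_all add: ext_simps)

lemma ext_eqI:
  assumes "x \<in> carrier E" "y \<in> carrier E" "\<And>S. S \<subseteq> {1..n} \<Longrightarrow> x S = y S"
  shows "x = y"
  using assms unfolding ext_simps by (rule PiE_ext) simp

lemma ext_smult_closed: "r \<in> carrier R \<Longrightarrow> x \<in> carrier E \<Longrightarrow> r \<odot>\<^bsub>E\<^esub> x \<in> carrier E"
  by (auto simp: ext_simps PiE_mem)

lemma ext_smult_r_distr:
  assumes "r \<in> carrier R" "x \<in> carrier E" "y \<in> carrier E"
  shows "r \<odot>\<^bsub>E\<^esub> (x \<oplus>\<^bsub>E\<^esub> y) = r \<odot>\<^bsub>E\<^esub> x \<oplus>\<^bsub>E\<^esub> r \<odot>\<^bsub>E\<^esub> y"
proof (rule ext_eqI)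
  fix S assume "S \<subseteq> {1..n}"
  then show "(r \<odot>\<^bsub>E\<^esub> (x \<oplus>\<^bsub>E\<^esub> y)) S = (r \<odot>\<^bsub>E\<^esub> x \<oplus>\<^bsub>E\<^esub> r \<odot>\<^bsub>E\<^esub> y) S"
    using ext_mem[OF assms(2)] ext_mem[OF assms(3)] assms(1) by (simp add: ext_simps r_distr)
qed (use assms ext_smult_closed in auto)

text \<open>Reduces negatives to scalars: a set closed under scalar multiples is then closed under
  negation.\<close>

lemma ext_minus_eq_smult:
  assumes "x \<in> carrier E"
  shows "\<ominus>\<^bsub>E\<^esub> x = (\<ominus> \<one>) \<odot>\<^bsub>E\<^esub> x"
proof (rule E.minus_equality)
  show "((\<ominus> \<one>) \<odot>\<^bsub>E\<^esub> x) \<oplus>\<^bsub>E\<^esub> x = \<zero>\<^bsub>E\<^esub>"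
  proof (rule ext_eqI)
    fix S assume "S \<subseteq> {1..n}"
    then show "(((\<ominus> \<one>) \<odot>\<^bsub>E\<^esub> x) \<oplus>\<^bsub>E\<^esub> x) S = \<zero>\<^bsub>E\<^esub> S"
      using ext_mem[OF assms] by (simp add: ext_simps l_minus l_neg)
  qed (use assms ext_smult_closed in auto)
qed (use assms ext_smult_closed in auto)

text \<open>Scalars have degree zero, so they pass either factor without a sign; commutativity of
  \<open>R\<close> lets them leave each summand.\<close>

lemma ext_smult_assoc:
  assumes r: "r \<in> carrier R" and x: "x \<in> carrier E" and y: "y \<in> carrier E"
  shows "(r \<odot>\<^bsub>E\<^esub> x) \<otimes>\<^bsub>E\<^esub> y = r \<odot>\<^bsub>E\<^esub> (x \<otimes>\<^bsub>E\<^esub> y)"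
    and "x \<otimes>\<^bsub>E\<^esub> (r \<odot>\<^bsub>E\<^esub> y) = r \<odot>\<^bsub>E\<^esub> (x \<otimes>\<^bsub>E\<^esub> y)"
proof -
  have *: "((r \<odot>\<^bsub>E\<^esub> x) \<otimes>\<^bsub>E\<^esub> y) S = (r \<odot>\<^bsub>E\<^esub> (x \<otimes>\<^bsub>E\<^esub> y)) S \<and> (x \<otimes>\<^bsub>E\<^esub> (r \<odot>\<^bsub>E\<^esub> y)) S = (r \<odot>\<^bsub>E\<^esub> (x \<otimes>\<^bsub>E\<^esub> y)) S"
    if S: "S \<subseteq> {1..n}" for S
  proof -
    have "finite S" using S finite_subset by blast
    have mem: "x T \<in> carrier R" "y (S - T) \<in> carrier R" if "T \<subseteq> S" for T
      using that S by (auto intro!: ext_mem[OF x] ext_mem[OF y])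
    have sub: "T \<subseteq> {1..n}" "S - T \<subseteq> {1..n}" if "T \<subseteq> S" for T using that S by auto
    let ?t = "\<lambda>T. (\<ominus> \<one>) [^] inversions T (S - T) \<otimes> (x T \<otimes> y (S - T))"
    have c: "?t \<in> Pow S \<rightarrow> carrier R"
      using mem by auto
    have "(r \<odot>\<^bsub>E\<^esub> (x \<otimes>\<^bsub>E\<^esub> y)) S = r \<otimes> (\<Oplus>T\<in>Pow S. ?t T)"
      using S by (simp add: ext_simps)
    also have "\<dots> = (\<Oplus>T\<in>Pow S. r \<otimes> ?t T)"
      using \<open>finite S\<close> r c by (intro finsum_rdistr) auto
    finally have 1: "(r \<odot>\<^bsub>E\<^esub> (x \<otimes>\<^bsub>E\<^esub> y)) S = (\<Oplus>T\<in>Pow S. r \<otimes> ?t T)" .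
    have "((r \<odot>\<^bsub>E\<^esub> x) \<otimes>\<^bsub>E\<^esub> y) S = (\<Oplus>T\<in>Pow S. r \<otimes> ?t T)"
      using S r by (simp add: ext_simps, intro finsum_cong' refl)
        (auto simp: sub mem m_ac)
    moreover have "(x \<otimes>\<^bsub>E\<^esub> (r \<odot>\<^bsub>E\<^esub> y)) S = (\<Oplus>T\<in>Pow S. r \<otimes> ?t T)"
      using S r by (simp add: ext_simps, intro finsum_cong' refl)
        (auto simp: sub mem m_ac)
    ultimately show ?thesis using 1 by simp
  qed
  show "(r \<odot>\<^bsub>E\<^esub> x) \<otimes>\<^bsub>E\<^esub> y = r \<odot>\<^bsub>E\<^esub> (x \<otimes>\<^bsub>E\<^esub> y)" "x \<otimes>\<^bsub>E\<^esub> (r \<odot>\<^bsub>E\<^esub> y) = r \<odot>\<^bsub>E\<^esub> (x \<otimes>\<^bsub>E\<^esub> y)"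
    by (rule ext_eqI; use * assms ext_smult_closed in auto)+
qed

lemma ext_finsum_apply:
  assumes "finite A" "f \<in> A \<rightarrow> carrier E" "S \<subseteq> {1..n}"
  shows "(\<Oplus>\<^bsub>E\<^esub>i\<in>A. f i) S = (\<Oplus>i\<in>A. f i S)"
  using assms(1,2)
proof (induction A)
  case empty
  show ?case using assms(3) by (simp add: ext_simps)
next
  case (insert a A)
  have "(\<Oplus>\<^bsub>E\<^esub>i\<in>insert a A. f i) = f a \<oplus>\<^bsub>E\<^esub> (\<Oplus>\<^bsub>E\<^esub>i\<in>A. f i)"
    using insert by (intro E.finsum_insert) auto
  moreover have "(\<Oplus>i\<in>insert a A. f i S) = f a S \<oplus> (\<Oplus>i\<in>A. f i S)"
    using insert assms(3) by (intro finsum_insert) (auto intro!: ext_mem)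
  ultimately show ?case
    using insert assms(3) by (simp add: ext_simps(5))
qed

text \<open>The notion \<open>ideal\<close> knows only ring multiplication, so the scalar
  \<open>r\<close> is realised as the ring element \<open>r\<close> times the unit.\<close>

lemma ideal_smult_closed:
  assumes "ideal I E" "r \<in> carrier R" "x \<in> I"
  shows "r \<odot>\<^bsub>E\<^esub> x \<in> I"
proof -
  interpret I: ideal I E by fact
  have x: "x \<in> carrier E" using assms(3) by (rule I.Icarr)
  have "(r \<odot>\<^bsub>E\<^esub> \<one>\<^bsub>E\<^esub>) \<otimes>\<^bsub>E\<^esub> x \<in> I"
    using assms by (intro I.I_l_closed ext_smult_closed) auto
  then show ?thesis using x assms(2) by (simp add: ext_smult_assoc)
qed

lemma ideal_finsum_closed:
  assumes "ideal I E" "finite A" "f \<in> A \<rightarrow> I"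
  shows "(\<Oplus>\<^bsub>E\<^esub>i\<in>A. f i) \<in> I"
proof -
  interpret I: ideal I E by fact
  show ?thesis
    using assms(2,3)
  proof (induction A)
    case (insert a A)
    have "(\<Oplus>\<^bsub>E\<^esub>i\<in>insert a A. f i) = f a \<oplus>\<^bsub>E\<^esub> (\<Oplus>\<^bsub>E\<^esub>i\<in>A. f i)"
      using insert I.Icarr by (intro E.finsum_insert) (auto simp: Pi_iff)
    then show ?case using insert by auto
  qed simp
qed

section \<open>Linear forms, their products, and boundaries of triples\<close>

text \<open>Prescribing the coefficients directly, instead of summing generators, lets products be
  evaluated one subset at a time; \<open>linear_form_expand\<close> supplies the link with the
  generators.\<close>

definition linear_form :: "(nat \<Rightarrow> 'a) \<Rightarrow> nat set \<Rightarrow> 'a" where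
  "linear_form \<xi> = (\<lambda>S\<in>Pow {1..n}. if card S = 1 then \<xi> (the_elem S) else \<zero>)"

lemma linear_form_closed [simp]: "\<xi> \<in> {1..n} \<rightarrow> carrier R \<Longrightarrow> linear_form \<xi> \<in> carrier E"
  by (auto simp: linear_form_def ext_simps card_1_singleton_iff Pi_iff)

lemma linear_form_singleton: "k \<in> {1..n} \<Longrightarrow> linear_form \<xi> {k} = \<xi> k"
  by (simp add: linear_form_def)

lemma linear_form_eq_zero: "S \<subseteq> {1..n} \<Longrightarrow> card S \<noteq> 1 \<Longrightarrow> linear_form \<xi> S = \<zero>"
  by (simp add: linear_form_def)

lemma ext_gen_eq_linear_form:
  "k \<in> {1..n} \<Longrightarrow> ext_gen R n k = linear_form (\<lambda>i. if i = k then \<one> else \<zero>)"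
  by (auto simp: ext_gen_def linear_form_def card_1_singleton_iff intro!: restrict_ext)

text \<open>Serves twice: with unit vectors in \<open>linear_form_expand\<close>, and with the
  coefficients of e_i - e_1 in \<open>linear_form_mult_memI\<close>.\<close>

lemma finsum_linear_form:
  assumes "finite A" "\<xi> \<in> A \<rightarrow> carrier R" "\<And>i. i \<in> A \<Longrightarrow> \<beta> i \<in> {1..n} \<rightarrow> carrier R"
  shows "(\<Oplus>\<^bsub>E\<^esub>i\<in>A. \<xi> i \<odot>\<^bsub>E\<^esub> linear_form (\<beta> i)) = linear_form (\<lambda>k. \<Oplus>i\<in>A. \<xi> i \<otimes> \<beta> i k)"
proof -
  have c: "\<xi> i \<odot>\<^bsub>E\<^esub> linear_form (\<beta> i) \<in> carrier E" if "i \<in> A" for i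
    using assms that by (intro ext_smult_closed) auto
  show ?thesis
  proof (rule ext_eqI)
    show "(\<Oplus>\<^bsub>E\<^esub>i\<in>A. \<xi> i \<odot>\<^bsub>E\<^esub> linear_form (\<beta> i)) \<in> carrier E"
      using c by (intro E.finsum_closed) auto
    show "linear_form (\<lambda>k. \<Oplus>i\<in>A. \<xi> i \<otimes> \<beta> i k) \<in> carrier E"
      using assms by (intro linear_form_closed) (auto intro!: finsum_closed m_closed)
    fix S assume S: "S \<subseteq> {1..n}"
    have "(\<Oplus>\<^bsub>E\<^esub>i\<in>A. \<xi> i \<odot>\<^bsub>E\<^esub> linear_form (\<beta> i)) S = (\<Oplus>i\<in>A. \<xi> i \<otimes> linear_form (\<beta> i) S)"
      using assms S c by (subst ext_finsum_apply) (auto simp: ext_simps(6))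
    also have "\<dots> = linear_form (\<lambda>k. \<Oplus>i\<in>A. \<xi> i \<otimes> \<beta> i k) S"
    proof (cases "card S = 1")
      case True
      then obtain k where "S = {k}" by (auto simp: card_1_singleton_iff)
      then show ?thesis using S by (simp add: linear_form_singleton)
    next
      case False
      then have "(\<Oplus>i\<in>A. \<xi> i \<otimes> linear_form (\<beta> i) S) = (\<Oplus>i\<in>A. \<zero>)"
        using S assms by (intro finsum_cong') (auto simp: linear_form_eq_zero Pi_iff)
      then show ?thesis using False S by (simp add: linear_form_eq_zero finsum_zero)
    qed
    finally show "(\<Oplus>\<^bsub>E\<^esub>i\<in>A. \<xi> i \<odot>\<^bsub>E\<^esub> linear_form (\<beta> i)) S = linear_form (\<lambda>k. \<Oplus>i\<in>A. \<xi> i \<otimes> \<beta> i k) S" .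
  qed
qed

lemma finsum_delta:
  assumes "\<xi> \<in> {1..n} \<rightarrow> carrier R" "k \<in> {1..n}"
  shows "(\<Oplus>i\<in>{1..n}. \<xi> i \<otimes> (if k = i then \<one> else \<zero>)) = \<xi> k"
proof -
  have "(\<Oplus>i\<in>{1..n}. \<xi> i \<otimes> (if k = i then \<one> else \<zero>)) = (\<Oplus>i\<in>{1..n}. if k = i then \<xi> i else \<zero>)"
    using assms by (intro finsum_cong') (auto simp: Pi_iff)
  also have "\<dots> = \<xi> k"
    using assms by (intro finsum_singleton) auto
  finally show ?thesis .
qed

lemma linear_form_expand:
  assumes "\<xi> \<in> {1..n} \<rightarrow> carrier R"
  shows "(\<Oplus>\<^bsub>E\<^esub>i\<in>{1..n}. \<xi> i \<odot>\<^bsub>E\<^esub> ext_gen R n i) = linear_form \<xi>"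
proof -
  have "(\<Oplus>\<^bsub>E\<^esub>i\<in>{1..n}. \<xi> i \<odot>\<^bsub>E\<^esub> ext_gen R n i)
      = (\<Oplus>\<^bsub>E\<^esub>i\<in>{1..n}. \<xi> i \<odot>\<^bsub>E\<^esub> linear_form (\<lambda>k. if k = i then \<one> else \<zero>))"
    using assms by (intro E.finsum_cong' refl)
      (auto simp: ext_gen_eq_linear_form intro!: ext_smult_closed)
  also have "\<dots> = linear_form (\<lambda>k. \<Oplus>i\<in>{1..n}. \<xi> i \<otimes> (if k = i then \<one> else \<zero>))"
    using assms by (intro finsum_linear_form) auto
  also have "\<dots> = linear_form \<xi>"
    unfolding linear_form_def
    using finsum_delta[OF assms] by (intro restrict_ext) (auto simp: card_1_singleton_iff)
  finally show ?thesis .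
qed

text \<open>Of the four ways to split \<open>{i, j}\<close> only the two into singletons survive,
  and the one starting with \<open>j\<close> carries the single inversion, hence the minus
  sign.\<close>

lemma linear_form_mult:
  assumes \<alpha>: "\<alpha> \<in> {1..n} \<rightarrow> carrier R" and \<beta>: "\<beta> \<in> {1..n} \<rightarrow> carrier R"
    and ij: "i \<in> {1..n}" "j \<in> {1..n}" "i < j"
  shows "(linear_form \<alpha> \<otimes>\<^bsub>E\<^esub> linear_form \<beta>) {i, j} = \<alpha> i \<otimes> \<beta> j \<ominus> \<alpha> j \<otimes> \<beta> i"
proof -
  have c: "\<alpha> i \<in> carrier R" "\<alpha> j \<in> carrier R" "\<beta> i \<in> carrier R" "\<beta> j \<in> carrier R"
    using assms by auto
  have inv: "inversions {i} {j} = 0" "inversions {j} {i} = 1"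
  proof -
    have "{(a, b). a \<in> {i} \<and> b \<in> {j} \<and> b < a} = {}" "{(a, b). a \<in> {j} \<and> b \<in> {i} \<and> b < a} = {(j, i)}"
      using ij(3) by auto
    then show "inversions {i} {j} = 0" "inversions {j} {i} = 1"
      unfolding inversions_def by (simp_all only: card.empty) simp
  qed
  have d: "{i, j} - {i} = {j}" "{i, j} - {j} = {i}" using ij(3) by auto
  have P: "Pow {i, j} = {{}, {i}, {j}, {i, j}}" by auto
  have ne: "{j} \<noteq> {i}" "{i, j} \<noteq> {i}" "{i, j} \<noteq> {j}" using ij(3) by auto
  have z: "linear_form \<xi> {} = \<zero>" "linear_form \<xi> {i, j} = \<zero>" for \<xi>
    using ij by (auto intro!: linear_form_eq_zero)
  have "(linear_form \<alpha> \<otimes>\<^bsub>E\<^esub> linear_form \<beta>) {i, j} =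
     (\<Oplus>T\<in>{{}, {i}, {j}, {i, j}}. (\<ominus> \<one>) [^] inversions T ({i, j} - T) \<otimes> (linear_form \<alpha> T \<otimes> linear_form \<beta> ({i, j} - T)))"
    using ij by (simp add: ext_simps(2) P)
  also have "\<dots> = \<alpha> i \<otimes> \<beta> j \<oplus> (\<ominus> \<one>) \<otimes> (\<alpha> j \<otimes> \<beta> i)"
    using c ne ij by (simp add: finsum_insert Pi_iff d inv z linear_form_singleton)
  finally show ?thesis using c by (simp add: minus_eq l_minus)
qed

text \<open>A nonzero summand would split \<open>S\<close> into two singletons.\<close>

lemma linear_form_mult_eq_zero:
  assumes \<alpha>: "\<alpha> \<in> {1..n} \<rightarrow> carrier R" and \<beta>: "\<beta> \<in> {1..n} \<rightarrow> carrier R"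
    and S: "S \<subseteq> {1..n}" "card S \<noteq> 2"
  shows "(linear_form \<alpha> \<otimes>\<^bsub>E\<^esub> linear_form \<beta>) S = \<zero>"
proof -
  have "finite S" using S finite_subset by blast
  have "(linear_form \<alpha> \<otimes>\<^bsub>E\<^esub> linear_form \<beta>) S =
     (\<Oplus>T\<in>Pow S. (\<ominus> \<one>) [^] inversions T (S - T) \<otimes> (linear_form \<alpha> T \<otimes> linear_form \<beta> (S - T)))"
    using S by (simp add: ext_simps(2))
  also have "\<dots> = (\<Oplus>T\<in>Pow S. \<zero>)"
  proof (intro finsum_cong' refl)
    fix T assume "T \<in> Pow S"
    then have T: "T \<subseteq> {1..n}" "S - T \<subseteq> {1..n}" "card S = card T + card (S - T)"
      using S \<open>finite S\<close> by (auto simp: card_Diff_subset finite_subset card_mono)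
    have "linear_form \<alpha> T \<otimes> linear_form \<beta> (S - T) = \<zero>"
    proof (cases "card T = 1")
      case True
      then have "linear_form \<beta> (S - T) = \<zero>" using T S by (intro linear_form_eq_zero) auto
      then show ?thesis using ext_mem[OF linear_form_closed[OF \<alpha>] T(1)] by simp
    next
      case False
      then have "linear_form \<alpha> T = \<zero>" using T by (intro linear_form_eq_zero) auto
      then show ?thesis using ext_mem[OF linear_form_closed[OF \<beta>] T(2)] by simp
    qed
    then show "(\<ominus> \<one>) [^] inversions T (S - T) \<otimes> (linear_form \<alpha> T \<otimes> linear_form \<beta> (S - T)) = \<zero>" by simp
  qed auto
  finally show ?thesis by simp
qed

text \<open>Tailored to products of linear forms: these vanish off two-element sets, and a pair
  needs testing in increasing order only.\<close>

lemma ext_two_eqI: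
  assumes "x \<in> carrier E" "y \<in> carrier E"
    and "\<And>S. S \<subseteq> {1..n} \<Longrightarrow> card S \<noteq> 2 \<Longrightarrow> x S = y S"
    and "\<And>i j. i \<in> {1..n} \<Longrightarrow> j \<in> {1..n} \<Longrightarrow> i < j \<Longrightarrow> x {i, j} = y {i, j}"
  shows "x = y"
proof (rule ext_eqI)
  fix S assume S: "S \<subseteq> {1..n}"
  show "x S = y S"
  proof (cases "card S = 2")
    case True
    then obtain i j where "S = {i, j}" "i \<noteq> j" by (auto simp: card_2_iff)
    then show ?thesis using assms(4)[of i j] assms(4)[of j i] S
      by (cases "i < j") (auto simp: insert_commute)
  qed (use assms(3) S in auto)
qed (use assms in auto)

text \<open>Turns the boundary into an explicit coefficient function: deleting \<open>a\<close>,
  \<open>b\<close>, \<open>c\<close> leaves the three pairs with signs +, -, +.\<close>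

lemma ext_boundary_triple:
  assumes abc: "a < b" "b < c" "{a, b, c} \<subseteq> {1..n}"
  shows "ext_boundary R n {a, b, c} = (\<lambda>S\<in>Pow {1..n}.
    if S = {b, c} then \<one> else if S = {a, c} then \<ominus> \<one> else if S = {a, b} then \<one> else \<zero>)"
proof -
  let ?m = "\<lambda>T. \<lambda>S\<in>Pow {1..n}. if S = T then \<one> else \<zero>"
  have s: "{j \<in> {a, b, c}. j < a} = {}" "{j \<in> {a, b, c}. j < b} = {a}" "{j \<in> {a, b, c}. j < c} = {a, b}"
    using abc by auto
  have d: "{a, b, c} - {a} = {b, c}" "{a, b, c} - {b} = {a, c}" "{a, b, c} - {c} = {a, b}"
    using abc by auto
  have mc: "?m T \<in> carrier E" for T by (auto simp: ext_simps)
  have sc: "r \<odot>\<^bsub>E\<^esub> ?m T \<in> carrier E" if "r \<in> carrier R" for r T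
    using that mc by (rule ext_smult_closed)
  have mon: "ext_monomial R n T = ?m T" if "T \<subseteq> {1..n}" for T
    using is_cring that by (rule ext_monomial_eq_basis)
  have m: "ext_monomial R n {b, c} = ?m {b, c}" "ext_monomial R n {a, c} = ?m {a, c}" "ext_monomial R n {a, b} = ?m {a, b}"
    using abc(3) by (intro mon; blast)+
  have ab: "card {a, b} = 2" using abc by simp
  have abc': "a \<notin> {b, c}" "b \<noteq> c" using abc by auto
  \<comment> \<open>The largest element \<open>c\<close> has two predecessors in the triple, so its
    sign is the square of -1.\<close>
  have p2: "(\<ominus> \<one>) [^] (2::nat) = \<one>"
    by (simp add: numeral_2_eq_2 l_minus r_minus)
  let ?f = "\<lambda>i. (\<ominus> \<one>) [^] card {j \<in> {a, b, c}. j < i} \<odot>\<^bsub>E\<^esub> ext_monomial R n ({a, b, c} - {i})"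
  have f: "?f a = \<one> \<odot>\<^bsub>E\<^esub> ?m {b, c}" "?f b = (\<ominus> \<one>) \<odot>\<^bsub>E\<^esub> ?m {a, c}" "?f c = \<one> \<odot>\<^bsub>E\<^esub> ?m {a, b}"
    unfolding s d m ab by (simp_all add: p2)
  have fc: "?f a \<in> carrier E" "?f b \<in> carrier E" "?f c \<in> carrier E"
    unfolding f by (intro sc; simp)+
  have "ext_boundary R n {a, b, c} = ?f a \<oplus>\<^bsub>E\<^esub> (?f b \<oplus>\<^bsub>E\<^esub> ?f c)"
  proof -
    have "(\<Oplus>\<^bsub>E\<^esub>i\<in>{a, b, c}. ?f i) = ?f a \<oplus>\<^bsub>E\<^esub> (\<Oplus>\<^bsub>E\<^esub>i\<in>{b, c}. ?f i)"
      using fc abc' by (intro E.finsum_insert) auto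
    also have "(\<Oplus>\<^bsub>E\<^esub>i\<in>{b, c}. ?f i) = ?f b \<oplus>\<^bsub>E\<^esub> (\<Oplus>\<^bsub>E\<^esub>i\<in>{c}. ?f i)"
      using fc abc' by (intro E.finsum_insert) auto
    also have "(\<Oplus>\<^bsub>E\<^esub>i\<in>{c}. ?f i) = ?f c \<oplus>\<^bsub>E\<^esub> (\<Oplus>\<^bsub>E\<^esub>i\<in>{}. ?f i)"
      using fc by (intro E.finsum_insert) auto
    finally show ?thesis using fc(3) by (simp add: ext_boundary_def)
  qed
  also have "\<dots> = (\<lambda>S\<in>Pow {1..n}.
      if S = {b, c} then \<one> else if S = {a, c} then \<ominus> \<one> else if S = {a, b} then \<one> else \<zero>)"
  proof -
    have ne: "{b, c} \<noteq> {a, c}" "{b, c} \<noteq> {a, b}" "{a, c} \<noteq> {a, b}" using abc by (auto simp: doubleton_eq_iff)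
    show ?thesis
    proof (rule ext_eqI)
      fix S assume S: "S \<subseteq> {1..n}"
      then have S': "S \<in> Pow {1..n}" by simp
      consider "S = {b, c}" | "S = {a, c}" | "S = {a, b}" | "S \<noteq> {b, c}" "S \<noteq> {a, c}" "S \<noteq> {a, b}" by blast
      then show "(?f a \<oplus>\<^bsub>E\<^esub> (?f b \<oplus>\<^bsub>E\<^esub> ?f c)) S = (\<lambda>S\<in>Pow {1..n}.
          if S = {b, c} then \<one> else if S = {a, c} then \<ominus> \<one> else if S = {a, b} then \<one> else \<zero>) S"
        unfolding f ext_apply[OF S] restrict_apply'[OF S'] by cases (simp_all add: ne ne[symmetric])
    next
      show "?f a \<oplus>\<^bsub>E\<^esub> (?f b \<oplus>\<^bsub>E\<^esub> ?f c) \<in> carrier E"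
        by (intro E.add.m_closed fc)
      show "(\<lambda>S\<in>Pow {1..n}. if S = {b, c} then \<one> else if S = {a, c} then \<ominus> \<one> else
          if S = {a, b} then \<one> else \<zero>) \<in> carrier E"
        by (simp add: ext_simps(1))
    qed
  qed
  finally show ?thesis .
qed


section \<open>The degree two boundary and its kernel\<close>

text \<open>
  \<open>contraction x k\<close> is the coefficient of \<open>e\<^sub>k\<close> in \<open>\<partial>x\<^sub>2\<close>, where \<open>x\<^sub>2\<close> is the degree two part
  of \<open>x\<close> and \<open>\<partial>(e\<^sub>i \<and> e\<^sub>j) = e\<^sub>j - e\<^sub>i\<close>.
\<close>

definition contraction :: "(nat set \<Rightarrow> 'a) \<Rightarrow> nat \<Rightarrow> 'a" where
  "contraction x k = (\<Oplus>i\<in>{1..n} - {k}. if i < k then x {i, k} else \<ominus> x {i, k})"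

text \<open>Only coefficients of pairs are read, so under \<open>contraction\<close> a product may
  be traded for any element with the same degree two part.\<close>

lemma contraction_cong:
  assumes "y \<in> carrier E" "k \<in> {1..n}" "\<And>S. S \<subseteq> {1..n} \<Longrightarrow> card S = 2 \<Longrightarrow> x S = y S"
  shows "contraction x k = contraction y k"
  unfolding contraction_def
proof (intro finsum_cong' refl)
  fix i assume i: "i \<in> {1..n} - {k}"
  then have "x {i, k} = y {i, k}" using assms(2) by (intro assms(3)) auto
  then show "(if i < k then x {i, k} else \<ominus> x {i, k}) = (if i < k then y {i, k} else \<ominus> y {i, k})" by simp
next
  show "(\<lambda>i. if i < k then y {i, k} else \<ominus> y {i, k}) \<in> {1..n} - {k} \<rightarrow> carrier R"
    using assms(2) ext_mem[OF assms(1)] by auto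
qed

lemma contraction_add:
  assumes "x \<in> carrier E" "y \<in> carrier E" "k \<in> {1..n}"
  shows "contraction (x \<oplus>\<^bsub>E\<^esub> y) k = contraction x k \<oplus> contraction y k"
proof -
  have c: "x {i, k} \<in> carrier R" "y {i, k} \<in> carrier R" if "i \<in> {1..n} - {k}" for i
    using assms that by (auto intro!: ext_mem)
  have "contraction (x \<oplus>\<^bsub>E\<^esub> y) k = (\<Oplus>i\<in>{1..n} - {k}. (if i < k then x {i, k} else \<ominus> x {i, k})
      \<oplus> (if i < k then y {i, k} else \<ominus> y {i, k}))"
    unfolding contraction_def using assms(3) c
    by (intro finsum_cong' refl) (auto simp: ext_simps(5) minus_add)
  also have "\<dots> = contraction x k \<oplus> contraction y k"
    unfolding contraction_def using c by (intro finsum_addf) auto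
  finally show ?thesis .
qed

lemma contraction_smult:
  assumes "r \<in> carrier R" "x \<in> carrier E" "k \<in> {1..n}"
  shows "contraction (r \<odot>\<^bsub>E\<^esub> x) k = r \<otimes> contraction x k"
proof -
  have c: "x {i, k} \<in> carrier R" if "i \<in> {1..n} - {k}" for i
    using assms that by (auto intro!: ext_mem)
  have "contraction (r \<odot>\<^bsub>E\<^esub> x) k = (\<Oplus>i\<in>{1..n} - {k}. r \<otimes> (if i < k then x {i, k} else \<ominus> x {i, k}))"
    unfolding contraction_def using assms c
    by (intro finsum_cong' refl) (auto simp: ext_simps(6) r_minus)
  also have "\<dots> = r \<otimes> contraction x k"
    unfolding contraction_def using assms c by (intro finsum_rdistr[symmetric]) auto
  finally show ?thesis .
qed

text \<open>Up to degree \<open>d\<close> the factor \<open>x\<close> can contribute only through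
  the full set \<open>S\<close>, which leaves the constant term \<open>r {}\<close> for the other
  factor. Splitting off the empty set creates no inversions, so both orders give the same
  value.\<close>

lemma mult_lowest_degree:
  assumes r: "r \<in> carrier E" and x: "x \<in> carrier E"
    and low: "\<And>T. T \<subseteq> {1..n} \<Longrightarrow> card T < d \<Longrightarrow> x T = \<zero>"
    and S: "S \<subseteq> {1..n}" "card S \<le> d"
  shows "(r \<otimes>\<^bsub>E\<^esub> x) S = r {} \<otimes> x S" and "(x \<otimes>\<^bsub>E\<^esub> r) S = r {} \<otimes> x S"
proof -
  have fin: "finite S" using S finite_subset by blast
  have mem: "r T \<in> carrier R" "x T \<in> carrier R" "r (S - T) \<in> carrier R" "x (S - T) \<in> carrier R"
    if "T \<subseteq> S" for T
    using that S by (auto intro!: ext_mem[OF r] ext_mem[OF x])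
  have zero: "x T = \<zero>" if "T \<subset> S" for T
    using psubset_card_mono[OF fin that] that S by (intro low) auto
  have zeroD: "x (S - T) = \<zero>" if "T \<subseteq> S" "T \<noteq> {}" for T
    using that by (intro zero) auto
  have "(r \<otimes>\<^bsub>E\<^esub> x) S = (\<Oplus>T\<in>Pow S. if {} = T then r T \<otimes> x (S - T) else \<zero>)"
    using S(1) by (simp add: ext_simps(2), intro finsum_cong' refl) (auto simp: mem zeroD)
  also have "\<dots> = r {} \<otimes> x (S - {})"
    using mem fin by (intro finsum_singleton) auto
  finally show "(r \<otimes>\<^bsub>E\<^esub> x) S = r {} \<otimes> x S" by simp
  have "(x \<otimes>\<^bsub>E\<^esub> r) S = (\<Oplus>T\<in>Pow S. if S = T then x T \<otimes> r (S - T) else \<zero>)"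
    using S(1) by (simp add: ext_simps(2), intro finsum_cong' refl) (auto simp: mem zero psubset_eq)
  also have "\<dots> = x S \<otimes> r (S - S)"
    using mem fin by (intro finsum_singleton) auto
  finally show "(x \<otimes>\<^bsub>E\<^esub> r) S = r {} \<otimes> x S"
    using mem[of S] mem[of "{}"] by (simp add: m_comm)
qed

text \<open>The vanishing below degree two is what makes this an ideal: otherwise multiplication
  could move a degree one term into degree two, where \<open>contraction\<close> sees it.\<close>

definition boundary_kernel :: "(nat set \<Rightarrow> 'a) set" where
  "boundary_kernel = {x \<in> carrier E. (\<forall>S. S \<subseteq> {1..n} \<longrightarrow> card S < 2 \<longrightarrow> x S = \<zero>) \<and>
     (\<forall>k\<in>{1..n}. contraction x k = \<zero>)}"

lemma boundary_kernel_smult: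
  assumes "r \<in> carrier R" "x \<in> boundary_kernel"
  shows "r \<odot>\<^bsub>E\<^esub> x \<in> boundary_kernel"
  using assms by (auto simp: boundary_kernel_def contraction_smult ext_smult_closed ext_apply)

lemma ideal_boundary_kernel: "ideal boundary_kernel E"
proof (rule idealI)
  show "ring E" by (rule E.ring_axioms)
  show "subgroup boundary_kernel (add_monoid E)"
  proof (rule E.add.subgroupI)
    show "boundary_kernel \<noteq> {}"
    proof -
      have "contraction \<zero>\<^bsub>E\<^esub> k = \<zero>" if "k \<in> {1..n}" for k
        unfolding contraction_def
      proof (rule add.finprod_one_eqI)
        fix i assume "i \<in> {1..n} - {k}"
        then have "{i, k} \<subseteq> {1..n}" using that by blast
        then show "(if i < k then \<zero>\<^bsub>E\<^esub> {i, k} else \<ominus> \<zero>\<^bsub>E\<^esub> {i, k}) = \<zero>"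
          by (simp only: ext_apply) simp
      qed
      then have "\<zero>\<^bsub>E\<^esub> \<in> boundary_kernel"
        by (simp add: boundary_kernel_def ext_apply)
      then show ?thesis by blast
    qed
    fix x assume x: "x \<in> boundary_kernel"
    then show "\<ominus>\<^bsub>E\<^esub> x \<in> boundary_kernel"
      using boundary_kernel_smult[of "\<ominus> \<one>" x]
      by (simp add: ext_minus_eq_smult boundary_kernel_def)
    fix y assume "y \<in> boundary_kernel"
    then show "x \<oplus>\<^bsub>E\<^esub> y \<in> boundary_kernel"
      using x by (simp add: boundary_kernel_def contraction_add ext_apply)
  qed (auto simp: boundary_kernel_def)
  fix x r assume x: "x \<in> boundary_kernel" and r: "r \<in> carrier E"
  have c: "x \<in> carrier E" "r {} \<in> carrier R"
    and low: "\<And>T. T \<subseteq> {1..n} \<Longrightarrow> card T < 2 \<Longrightarrow> x T = \<zero>"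
    and con: "\<And>k. k \<in> {1..n} \<Longrightarrow> contraction x k = \<zero>"
    using x ext_mem[OF r] by (auto simp: boundary_kernel_def)
  \<comment> \<open>Taken with \<open>d = 2\<close>: on the degree two part, multiplication by
    \<open>r\<close> from either side is scaling by \<open>r {}\<close>, and
    \<open>contraction\<close> is linear.\<close>
  note lowest = mult_lowest_degree[OF r c(1) low]
  have "contraction (r \<otimes>\<^bsub>E\<^esub> x) k = \<zero> \<and> contraction (x \<otimes>\<^bsub>E\<^esub> r) k = \<zero>" if k: "k \<in> {1..n}" for k
  proof -
    have "contraction (r \<otimes>\<^bsub>E\<^esub> x) k = contraction (r {} \<odot>\<^bsub>E\<^esub> x) k"
      using c k lowest(1) by (intro contraction_cong ext_smult_closed) (auto simp: ext_simps(6))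
    moreover have "contraction (x \<otimes>\<^bsub>E\<^esub> r) k = contraction (r {} \<odot>\<^bsub>E\<^esub> x) k"
      using c k lowest(2) by (intro contraction_cong ext_smult_closed) (auto simp: ext_simps(6))
    ultimately show ?thesis using k c con by (simp add: contraction_smult)
  qed
  then show "r \<otimes>\<^bsub>E\<^esub> x \<in> boundary_kernel" "x \<otimes>\<^bsub>E\<^esub> r \<in> boundary_kernel"
    using c r lowest low by (auto simp: boundary_kernel_def)
qed

text \<open>This is the vanishing of the double boundary for a triangle: at each vertex the two
  edges through it contribute opposite signs.\<close>

lemma ext_boundary_triple_in_kernel:
  assumes abc: "a < b" "b < c" "{a, b, c} \<subseteq> {1..n}"
  shows "ext_boundary R n {a, b, c} \<in> boundary_kernel"
proof -
  let ?x = "ext_boundary R n {a, b, c}"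
  note val = ext_boundary_triple[OF abc]
  have carr: "?x \<in> carrier E" unfolding val by (auto simp: ext_simps)
  have low: "?x S = \<zero>" if "S \<subseteq> {1..n}" "card S < 2" for S
    unfolding val using that abc by auto
  have "contraction ?x k = \<zero>" if k: "k \<in> {1..n}" for k
  proof -
    let ?f = "\<lambda>i. if i < k then ?x {i, k} else \<ominus> ?x {i, k}"
    have fc: "?f i \<in> carrier R" if "i \<in> {1..n} - {k}" for i
      using that k ext_mem[OF carr] by auto
    have v: "?x {i, k} = (if {i, k} = {b, c} then \<one> else if {i, k} = {a, c} then \<ominus> \<one> else if {i, k} = {a, b} then \<one> else \<zero>)"
      if "i \<in> {1..n} - {k}" for i
      using that k unfolding val by simp
    \<comment> \<open>A pair containing \<open>k\<close> has a nonzero coefficient only if it lies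
      in the triple, so the sum shrinks to the other two vertices, or to nothing when
      \<open>k\<close> is outside.\<close>
    have "contraction ?x k = (\<Oplus>i\<in>(if k \<in> {a, b, c} then {a, b, c} - {k} else {}). ?f i)"
      unfolding contraction_def
    proof (rule add.finprod_mono_neutral_cong_right)
      fix i assume i: "i \<in> {1..n} - {k} - (if k \<in> {a, b, c} then {a, b, c} - {k} else {})"
      then have "{i, k} \<noteq> {b, c}" "{i, k} \<noteq> {a, c}" "{i, k} \<noteq> {a, b}"
        by (auto simp: doubleton_eq_iff split: if_splits)
      then show "?f i = \<zero>" using v[of i] i by simp
    qed (use abc fc in auto)
    also have "\<dots> = \<zero>"
    proof -
      consider "k = a" | "k = b" | "k = c" | "k \<notin> {a, b, c}" by blast
      then show ?thesis
      proof cases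
        case 1
        have "{a, b, c} - {a} = {b, c}" using abc by auto
        moreover have "?f b = \<ominus> \<one>" "?f c = \<one>"
          using abc 1 v[of b] v[of c] by (auto simp: doubleton_eq_iff)
        ultimately show ?thesis using abc 1 by (simp add: l_neg)
      next
        case 2
        have "{a, b, c} - {b} = {a, c}" using abc by auto
        moreover have "?f a = \<one>" "?f c = \<ominus> \<one>"
          using abc 2 v[of a] v[of c] by (auto simp: doubleton_eq_iff)
        ultimately show ?thesis using abc 2 by (simp add: r_neg)
      next
        case 3
        have "{a, b, c} - {c} = {a, b}" using abc by auto
        moreover have "?f a = \<ominus> \<one>" "?f b = \<one>"
          using abc 3 v[of a] v[of b] by (auto simp: doubleton_eq_iff)
        ultimately show ?thesis using abc 3 by (simp add: l_neg)
      qed simp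
    qed
    finally show ?thesis .
  qed
  then show ?thesis using carr low by (auto simp: boundary_kernel_def)
qed

lemma contraction_linear_form_mult:
  assumes \<alpha>: "\<alpha> \<in> {1..n} \<rightarrow> carrier R" and \<beta>: "\<beta> \<in> {1..n} \<rightarrow> carrier R" and k: "k \<in> {1..n}"
  shows "contraction (linear_form \<alpha> \<otimes>\<^bsub>E\<^esub> linear_form \<beta>) k
    = coord_sum R \<alpha> {1..n} \<otimes> \<beta> k \<ominus> coord_sum R \<beta> {1..n} \<otimes> \<alpha> k"
proof -
  have c: "\<alpha> i \<in> carrier R" "\<beta> i \<in> carrier R" if "i \<in> {1..n}" for i
    using \<alpha> \<beta> that by auto
  \<comment> \<open>The new summand at \<open>i = k\<close> is zero by commutativity, so the range
    may be completed to all indices. Keeping the factors with index \<open>k\<close> on the right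
    allows them to be pulled out of the sums.\<close>
  have "contraction (linear_form \<alpha> \<otimes>\<^bsub>E\<^esub> linear_form \<beta>) k = (\<Oplus>i\<in>{1..n}. \<alpha> i \<otimes> \<beta> k \<oplus> \<beta> i \<otimes> (\<ominus> \<alpha> k))"
    unfolding contraction_def
  proof (rule add.finprod_mono_neutral_cong_left)
    fix i assume i: "i \<in> {1..n} - {k}"
    show "(if i < k then (linear_form \<alpha> \<otimes>\<^bsub>E\<^esub> linear_form \<beta>) {i, k} else \<ominus> (linear_form \<alpha> \<otimes>\<^bsub>E\<^esub> linear_form \<beta>) {i, k})
       = \<alpha> i \<otimes> \<beta> k \<oplus> \<beta> i \<otimes> (\<ominus> \<alpha> k)"
    proof (cases "i < k")
      case True
      then show ?thesis using linear_form_mult[OF \<alpha> \<beta> _ k True] i c k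
        by (simp add: minus_eq r_minus m_comm)
    next
      case False
      then have "k < i" using i by auto
      then have "(linear_form \<alpha> \<otimes>\<^bsub>E\<^esub> linear_form \<beta>) {i, k} = \<alpha> k \<otimes> \<beta> i \<ominus> \<alpha> i \<otimes> \<beta> k"
        using linear_form_mult[OF \<alpha> \<beta> k, of i] i by (simp add: insert_commute)
      then show ?thesis using False i c k
        by (simp add: minus_eq r_minus m_comm minus_add a_comm)
    qed
  qed (use c k in \<open>auto simp: r_minus m_comm r_neg\<close>)
  also have "\<dots> = (\<Oplus>i\<in>{1..n}. \<alpha> i \<otimes> \<beta> k) \<oplus> (\<Oplus>i\<in>{1..n}. \<beta> i \<otimes> (\<ominus> \<alpha> k))"
    using c k by (intro finsum_addf) auto
  also have "\<dots> = (\<Oplus>i\<in>{1..n}. \<alpha> i) \<otimes> \<beta> k \<oplus> (\<Oplus>i\<in>{1..n}. \<beta> i) \<otimes> (\<ominus> \<alpha> k)"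
    using c k \<alpha> \<beta> by (simp add: finsum_ldistr)
  finally show ?thesis
    using c k \<alpha> \<beta> by (simp add: coord_sum_def minus_eq r_minus)
qed

section \<open>Membership of a product of linear forms in the ideal\<close>

text \<open>The ideal is kept abstract because all that enters is the boundaries of triples through
  1: the index 1 acts as base point, and products of the differences e_i - e_1 are such boundaries
  up to sign, or zero.\<close>

lemma linear_form_mult_memI:
  assumes I: "ideal I E"
    and circ: "\<And>i j. 1 < i \<Longrightarrow> i < j \<Longrightarrow> j \<le> n \<Longrightarrow> ext_boundary R n {1, i, j} \<in> I"
    and \<alpha>: "\<alpha> \<in> {1..n} \<rightarrow> carrier R" and \<beta>: "\<beta> \<in> {1..n} \<rightarrow> carrier R"
    and eq: "\<And>k. k \<in> {1..n} \<Longrightarrow> coord_sum R \<alpha> {1..n} \<otimes> \<beta> k \<ominus> coord_sum R \<beta> {1..n} \<otimes> \<alpha> k = \<zero>"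
  shows "linear_form \<alpha> \<otimes>\<^bsub>E\<^esub> linear_form \<beta> \<in> I"
proof -
  interpret I: ideal I E by fact
  \<comment> \<open>\<open>D i\<close> is \<open>e\<^sub>i - e\<^sub>1\<close>.  For \<open>1 < i < j\<close> the product \<open>D i \<and> D j\<close> is the boundary of \<open>{1, i, j}\<close>.\<close>
  define d where "d i k = (if k = i then \<one> else \<zero>) \<oplus> (if k = 1 then \<ominus> \<one> else \<zero>)" for i k :: nat
  have dc: "d i \<in> {1..n} \<rightarrow> carrier R" for i by (auto simp: d_def)
  \<comment> \<open>The two conditionals in \<open>d\<close> are added rather than nested, so at the
    base point they cancel and \<open>D 1\<close> is zero.\<close>
  have d1: "d i k = \<zero>" if "i = 1" for i k using that by (auto simp: d_def r_neg)
  define D where "D i = linear_form (d i)" for i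
  have Dc: "D i \<in> carrier E" for i unfolding D_def by (rule linear_form_closed[OF dc])
  have dd: "d i a \<in> carrier R" for i a by (simp add: d_def)
  have lt: "D i \<otimes>\<^bsub>E\<^esub> D j \<in> I" if ij: "i \<in> {1..n}" "j \<in> {1..n}" "i < j" for i j
  proof (cases "i = 1")
    case True
    have "D i \<otimes>\<^bsub>E\<^esub> D j = \<zero>\<^bsub>E\<^esub>"
    proof (rule ext_two_eqI)
      fix a b assume ab: "a \<in> {1..n}" "b \<in> {1..n}" "a < b"
      show "(D i \<otimes>\<^bsub>E\<^esub> D j) {a, b} = \<zero>\<^bsub>E\<^esub> {a, b}"
        unfolding D_def linear_form_mult[OF dc dc ab] using ab d1[OF True] dd by (simp add: ext_apply r_neg minus_eq)
    qed (use Dc in \<open>auto simp: D_def linear_form_mult_eq_zero[OF dc dc] ext_apply\<close>)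
    then show ?thesis by simp
  next
    case False
    then have i1: "1 < i" "{1, i, j} \<subseteq> {1..n}" using ij by auto
    note val = ext_boundary_triple[OF i1(1) ij(3) i1(2)]
    have bc: "ext_boundary R n {1, i, j} \<in> carrier E" unfolding val by (auto simp: ext_simps)
    have "D i \<otimes>\<^bsub>E\<^esub> D j = ext_boundary R n {1, i, j}"
    proof (rule ext_two_eqI)
      fix a b assume ab: "a \<in> {1..n}" "b \<in> {1..n}" "a < b"
      \<comment> \<open>The entry -1 of \<open>d\<close> sits at index 1, which can only be the
        smaller index \<open>a\<close>; at \<open>b\<close> only the unit entry remains.\<close>
      have b1: "b \<noteq> 1" using ab by auto
      have 1: "(D i \<otimes>\<^bsub>E\<^esub> D j) {a, b} = d i a \<otimes> d j b \<ominus> d i b \<otimes> d j a"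
        unfolding D_def by (rule linear_form_mult[OF dc dc ab])
      have 2: "d i b = (if b = i then \<one> else \<zero>)" "d j b = (if b = j then \<one> else \<zero>)"
        using b1 by (auto simp: d_def)
      have 3: "d i a = (if a = i then \<one> else if a = 1 then \<ominus> \<one> else \<zero>)"
        "d j a = (if a = j then \<one> else if a = 1 then \<ominus> \<one> else \<zero>)"
        using i1 ij by (auto simp: d_def)
      have sub: "{a, b} \<in> Pow {1..n}" using ab by auto
      have 4: "ext_boundary R n {1, i, j} {a, b} =
         (if a = i \<and> b = j then \<one> else if a = 1 \<and> b = j then \<ominus> \<one> else if a = 1 \<and> b = i then \<one> else \<zero>)"
        unfolding val restrict_apply'[OF sub] using ab i1(1) ij(3) by (auto simp: doubleton_eq_iff)
      show "(D i \<otimes>\<^bsub>E\<^esub> D j) {a, b} = ext_boundary R n {1, i, j} {a, b}"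
        unfolding 1 2 3 4 using ab i1(1) ij(3) by (auto simp: minus_eq)
    next
      fix S assume S: "S \<subseteq> {1..n}" "card S \<noteq> 2"
      then have "ext_boundary R n {1, i, j} S = \<zero>"
        unfolding val using i1(1) ij(3) by auto
      then show "(D i \<otimes>\<^bsub>E\<^esub> D j) S = ext_boundary R n {1, i, j} S"
        using S by (simp add: D_def linear_form_mult_eq_zero[OF dc dc])
    qed (use Dc bc in auto)
    then show ?thesis using circ[OF i1(1) ij(3)] ij by simp
  qed
  have DD: "D i \<otimes>\<^bsub>E\<^esub> D j \<in> I" if ij: "i \<in> {1..n}" "j \<in> {1..n}" for i j
  proof -
    consider "i < j" | "j < i" | "i = j" by linarith
    then show ?thesis
    proof cases
      case 2
      \<comment> \<open>Anticommutativity is read off the minor formula for the coefficients and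
        reduces this case to the previous one.\<close>
      have "D i \<otimes>\<^bsub>E\<^esub> D j = (\<ominus> \<one>) \<odot>\<^bsub>E\<^esub> (D j \<otimes>\<^bsub>E\<^esub> D i)"
      proof (rule ext_two_eqI)
        fix a b assume ab: "a \<in> {1..n}" "b \<in> {1..n}" "a < b"
        have 1: "(D i \<otimes>\<^bsub>E\<^esub> D j) {a, b} = d i a \<otimes> d j b \<ominus> d i b \<otimes> d j a" for i j
          unfolding D_def by (rule linear_form_mult[OF dc dc ab])
        have sub: "{a, b} \<in> Pow {1..n}" using ab by auto
        show "(D i \<otimes>\<^bsub>E\<^esub> D j) {a, b} = ((\<ominus> \<one>) \<odot>\<^bsub>E\<^esub> (D j \<otimes>\<^bsub>E\<^esub> D i)) {a, b}"
          unfolding ext_simps(6) restrict_apply'[OF sub] 1 using dd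
          by (simp add: minus_eq l_minus minus_add m_comm a_comm)
      qed (use Dc in \<open>auto simp: D_def linear_form_mult_eq_zero[OF dc dc] ext_apply intro!: ext_smult_closed\<close>)
      then show ?thesis using lt[OF ij(2,1) 2] ideal_smult_closed[OF I] by simp
    next
      case 3
      \<comment> \<open>Anticommutativity alone would only show that twice this product vanishes;
        over a general \<open>R\<close> the minors with equal columns are used instead.\<close>
      have "D i \<otimes>\<^bsub>E\<^esub> D i = \<zero>\<^bsub>E\<^esub>"
      proof (rule ext_two_eqI)
        fix a b assume ab: "a \<in> {1..n}" "b \<in> {1..n}" "a < b"
        show "(D i \<otimes>\<^bsub>E\<^esub> D i) {a, b} = \<zero>\<^bsub>E\<^esub> {a, b}"
          unfolding D_def linear_form_mult[OF dc dc ab] using ab dd[of i a] dd[of i b]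
          by (simp add: ext_apply r_neg minus_eq m_comm)
      qed (use Dc in \<open>auto simp: D_def linear_form_mult_eq_zero[OF dc dc] ext_apply\<close>)
      then show ?thesis using 3 by simp
    qed (use lt ij in blast)
  qed
  \<comment> \<open>\<open>F \<xi>\<close> is \<open>\<xi>\<close> minus its coordinate sum times \<open>e\<^sub>1\<close>; the hypothesis makes this correction
    disappear from \<open>F \<alpha> \<and> F \<beta>\<close>.\<close>
  define F where "F \<xi> = (\<Oplus>\<^bsub>E\<^esub>i\<in>{1..n}. \<xi> i \<odot>\<^bsub>E\<^esub> D i)" for \<xi>
  define s where "s \<xi> k = \<xi> k \<oplus> coord_sum R \<xi> {1..n} \<otimes> (if k = 1 then \<ominus> \<one> else \<zero>)" for \<xi> and k :: nat
  have Fs: "F \<xi> = linear_form (s \<xi>)" if \<xi>: "\<xi> \<in> {1..n} \<rightarrow> carrier R" for \<xi>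
  proof -
    have \<xi>': "\<xi> i \<in> carrier R" if "i \<in> {1..n}" for i using \<xi> that by auto
    have "F \<xi> = linear_form (\<lambda>k. \<Oplus>i\<in>{1..n}. \<xi> i \<otimes> d i k)"
      unfolding F_def D_def using \<xi> dc by (intro finsum_linear_form) auto
    moreover have "(\<Oplus>i\<in>{1..n}. \<xi> i \<otimes> d i k) = s \<xi> k" if k: "k \<in> {1..n}" for k
    proof -
      have "(\<Oplus>i\<in>{1..n}. \<xi> i \<otimes> d i k)
         = (\<Oplus>i\<in>{1..n}. \<xi> i \<otimes> (if k = i then \<one> else \<zero>) \<oplus> \<xi> i \<otimes> (if k = 1 then \<ominus> \<one> else \<zero>))"
        unfolding d_def by (intro finsum_cong' refl) (use \<xi>' in \<open>auto simp: r_distr\<close>)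
      also have "\<dots> = (\<Oplus>i\<in>{1..n}. \<xi> i \<otimes> (if k = i then \<one> else \<zero>)) \<oplus> (\<Oplus>i\<in>{1..n}. \<xi> i \<otimes> (if k = 1 then \<ominus> \<one> else \<zero>))"
        using \<xi>' by (intro finsum_addf) auto
      also have "(\<Oplus>i\<in>{1..n}. \<xi> i \<otimes> (if k = 1 then \<ominus> \<one> else \<zero>)) = coord_sum R \<xi> {1..n} \<otimes> (if k = 1 then \<ominus> \<one> else \<zero>)"
        unfolding coord_sum_def using \<xi> by (intro finsum_ldistr[symmetric]) auto
      finally show ?thesis unfolding s_def finsum_delta[OF \<xi> k] .
    qed
    ultimately show ?thesis
      unfolding linear_form_def by (auto intro!: restrict_ext simp: card_1_singleton_iff)
  qed
  \<comment> \<open>Bilinear expansion, one factor at a time, into multiples of the products covered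
    by \<open>DD\<close>.\<close>
  have "F \<alpha> \<otimes>\<^bsub>E\<^esub> F \<beta> \<in> I"
  proof -
    have c: "\<alpha> i \<in> carrier R" "\<beta> i \<in> carrier R" if "i \<in> {1..n}" for i using \<alpha> \<beta> that by auto
    have Fc: "F \<beta> \<in> carrier E"
      unfolding F_def using c Dc by (intro E.finsum_closed) (auto intro!: ext_smult_closed)
    have DF: "D i \<otimes>\<^bsub>E\<^esub> F \<beta> \<in> I" if i: "i \<in> {1..n}" for i
    proof -
      have "D i \<otimes>\<^bsub>E\<^esub> F \<beta> = (\<Oplus>\<^bsub>E\<^esub>j\<in>{1..n}. D i \<otimes>\<^bsub>E\<^esub> (\<beta> j \<odot>\<^bsub>E\<^esub> D j))"
        unfolding F_def using c Dc by (intro E.finsum_rdistr) (auto intro!: ext_smult_closed)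
      also have "\<dots> \<in> I"
        using c Dc DD i by (intro ideal_finsum_closed I) (auto simp: ext_smult_assoc intro!: ideal_smult_closed I)
      finally show ?thesis .
    qed
    have "F \<alpha> \<otimes>\<^bsub>E\<^esub> F \<beta> = (\<Oplus>\<^bsub>E\<^esub>i\<in>{1..n}. (\<alpha> i \<odot>\<^bsub>E\<^esub> D i) \<otimes>\<^bsub>E\<^esub> F \<beta>)"
      unfolding F_def[of \<alpha>] using c Dc Fc by (intro E.finsum_ldistr) (auto intro!: ext_smult_closed)
    also have "\<dots> \<in> I"
      using c Dc Fc DF by (intro ideal_finsum_closed I) (auto simp: ext_smult_assoc intro!: ideal_smult_closed I)
    finally show ?thesis .
  qed
  moreover have "linear_form (s \<alpha>) \<otimes>\<^bsub>E\<^esub> linear_form (s \<beta>) = linear_form \<alpha> \<otimes>\<^bsub>E\<^esub> linear_form \<beta>"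
  proof (rule ext_two_eqI)
    have Lc: "coord_sum R \<alpha> {1..n} \<in> carrier R" "coord_sum R \<beta> {1..n} \<in> carrier R"
      using \<alpha> \<beta> by (auto simp: coord_sum_def intro!: finsum_closed)
    have sc: "s \<alpha> \<in> {1..n} \<rightarrow> carrier R" "s \<beta> \<in> {1..n} \<rightarrow> carrier R"
      using \<alpha> \<beta> Lc by (auto simp: s_def Pi_iff)
    show "linear_form (s \<alpha>) \<otimes>\<^bsub>E\<^esub> linear_form (s \<beta>) \<in> carrier E" "linear_form \<alpha> \<otimes>\<^bsub>E\<^esub> linear_form \<beta> \<in> carrier E"
      using sc \<alpha> \<beta> by auto
    show "(linear_form (s \<alpha>) \<otimes>\<^bsub>E\<^esub> linear_form (s \<beta>)) S = (linear_form \<alpha> \<otimes>\<^bsub>E\<^esub> linear_form \<beta>) S"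
      if "S \<subseteq> {1..n}" "card S \<noteq> 2" for S
      using that sc \<alpha> \<beta> by (simp add: linear_form_mult_eq_zero)
    fix a b assume ab: "a \<in> {1..n}" "b \<in> {1..n}" "a < b"
    have c: "\<alpha> a \<in> carrier R" "\<alpha> b \<in> carrier R" "\<beta> a \<in> carrier R" "\<beta> b \<in> carrier R"
      using \<alpha> \<beta> ab by auto
    \<comment> \<open>Since \<open>a < b\<close>, the index \<open>b\<close> is not 1 and its
      coefficients are uncorrected.\<close>
    have sb: "s \<alpha> b = \<alpha> b" "s \<beta> b = \<beta> b" using ab c Lc by (auto simp: s_def)
    have "s \<alpha> a \<otimes> \<beta> b \<ominus> \<alpha> b \<otimes> s \<beta> a = \<alpha> a \<otimes> \<beta> b \<ominus> \<alpha> b \<otimes> \<beta> a"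
    proof (cases "a = 1")
      case True
      define L M where "L = coord_sum R \<alpha> {1..n}" and "M = coord_sum R \<beta> {1..n}"
      have LM: "L \<in> carrier R" "M \<in> carrier R" using Lc by (simp_all add: L_def M_def)
      have e: "L \<otimes> \<beta> b = M \<otimes> \<alpha> b"
        using eq[OF ab(2)] Lc c by (simp add: L_def M_def)
      \<comment> \<open>The corrections to the minor collect into the expression of the hypothesis
        at index \<open>b\<close>, which \<open>e\<close> makes vanish.\<close>
      have "(\<alpha> a \<oplus> L \<otimes> (\<ominus> \<one>)) \<otimes> \<beta> b \<ominus> \<alpha> b \<otimes> (\<beta> a \<oplus> M \<otimes> (\<ominus> \<one>))
          = (\<alpha> a \<otimes> \<beta> b \<ominus> \<alpha> b \<otimes> \<beta> a) \<ominus> (L \<otimes> \<beta> b \<ominus> M \<otimes> \<alpha> b)"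
        using c LM by algebra
      also have "\<dots> = \<alpha> a \<otimes> \<beta> b \<ominus> \<alpha> b \<otimes> \<beta> a"
        unfolding e using c LM by algebra
      finally show ?thesis using True by (simp add: s_def L_def M_def)
    next
      case False
      then show ?thesis using c Lc by (simp add: s_def)
    qed
    then show "(linear_form (s \<alpha>) \<otimes>\<^bsub>E\<^esub> linear_form (s \<beta>)) {a, b} = (linear_form \<alpha> \<otimes>\<^bsub>E\<^esub> linear_form \<beta>) {a, b}"
      unfolding linear_form_mult[OF sc ab] linear_form_mult[OF \<alpha> \<beta> ab] sb .
  qed
  ultimately show ?thesis using Fs \<alpha> \<beta> by simp
qed

text \<open>Forwards, membership is tested against \<open>boundary_kernel\<close>, an ideal
  containing all generators; backwards, \<open>linear_form_mult_memI\<close> is fed the triples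
  through 1.\<close>

lemma linear_form_mult_mem_iff:
  assumes \<alpha>: "\<alpha> \<in> {1..n} \<rightarrow> carrier R" and \<beta>: "\<beta> \<in> {1..n} \<rightarrow> carrier R"
  shows "linear_form \<alpha> \<otimes>\<^bsub>E\<^esub> linear_form \<beta> \<in> OS_ideal R n {C. C \<subseteq> {1..n} \<and> card C = 3} \<longleftrightarrow>
    (\<forall>k\<in>{1..n}. coord_sum R \<alpha> {1..n} \<otimes> \<beta> k \<ominus> coord_sum R \<beta> {1..n} \<otimes> \<alpha> k = \<zero>)"
proof -
  let ?G = "ext_boundary R n ` {C. C \<subseteq> {1..n} \<and> card C = 3}"
  have G: "?G \<subseteq> boundary_kernel"
    by (auto elim!: card_3_orderedE intro!: ext_boundary_triple_in_kernel)
  then have Gc: "?G \<subseteq> carrier E" by (auto simp: boundary_kernel_def)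
  have sub: "OS_ideal R n {C. C \<subseteq> {1..n} \<and> card C = 3} \<subseteq> boundary_kernel"
    unfolding OS_ideal_def by (rule E.genideal_minimal[OF ideal_boundary_kernel G])
  show ?thesis
  proof
    assume "linear_form \<alpha> \<otimes>\<^bsub>E\<^esub> linear_form \<beta> \<in> OS_ideal R n {C. C \<subseteq> {1..n} \<and> card C = 3}"
    then have "linear_form \<alpha> \<otimes>\<^bsub>E\<^esub> linear_form \<beta> \<in> boundary_kernel" using sub by blast
    then show "\<forall>k\<in>{1..n}. coord_sum R \<alpha> {1..n} \<otimes> \<beta> k \<ominus> coord_sum R \<beta> {1..n} \<otimes> \<alpha> k = \<zero>"
      by (simp add: boundary_kernel_def contraction_linear_form_mult[OF \<alpha> \<beta>])
  next
    assume eq: "\<forall>k\<in>{1..n}. coord_sum R \<alpha> {1..n} \<otimes> \<beta> k \<ominus> coord_sum R \<beta> {1..n} \<otimes> \<alpha> k = \<zero>"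
    show "linear_form \<alpha> \<otimes>\<^bsub>E\<^esub> linear_form \<beta> \<in> OS_ideal R n {C. C \<subseteq> {1..n} \<and> card C = 3}"
    proof (rule linear_form_mult_memI[OF _ _ \<alpha> \<beta>])
      show "ideal (OS_ideal R n {C. C \<subseteq> {1..n} \<and> card C = 3}) E"
        unfolding OS_ideal_def by (rule E.genideal_ideal[OF Gc])
      fix i j assume "1 < i" "i < j" "j \<le> n"
      then have "ext_boundary R n {1, i, j} \<in> ?G" by (intro imageI) auto
      then show "ext_boundary R n {1, i, j} \<in> OS_ideal R n {C. C \<subseteq> {1..n} \<and> card C = 3}"
        unfolding OS_ideal_def using E.genideal_self[OF Gc] by blast
    qed (use eq in auto)
  qed
qed

section \<open>Passage to the quotient algebra\<close>

lemma OS_linear_mult_eq_zero_iff: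
  assumes "ext_boundary R n ` \<C> \<subseteq> carrier E"
    and \<alpha>: "\<alpha> \<in> {1..n} \<rightarrow> carrier R" and \<beta>: "\<beta> \<in> {1..n} \<rightarrow> carrier R"
  shows "OS_linear R n \<C> \<alpha> \<otimes>\<^bsub>OS_algebra R n \<C>\<^esub> OS_linear R n \<C> \<beta> = \<zero>\<^bsub>OS_algebra R n \<C>\<^esub>
    \<longleftrightarrow> linear_form \<alpha> \<otimes>\<^bsub>E\<^esub> linear_form \<beta> \<in> OS_ideal R n \<C>"
proof -
  define I where "I = OS_ideal R n \<C>"
  interpret I: ideal I E
    unfolding I_def OS_ideal_def by (rule E.genideal_ideal[OF assms(1)])
  interpret Q: ring "E Quot I" by (rule I.quotient_is_ring)
  interpret h: ring_hom_ring E "E Quot I" "(+>\<^bsub>E\<^esub>) I" by (rule I.rcos_ring_hom_ring)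
  \<comment> \<open>Scalar multiplication on a coset is a union over its representatives. They all
    yield the same coset because \<open>I\<close> is closed under scalars.\<close>
  have smult: "(r \<odot>\<^bsub>OS_algebra R n \<C>\<^esub> (I +>\<^bsub>E\<^esub> x)) = I +>\<^bsub>E\<^esub> (r \<odot>\<^bsub>E\<^esub> x)"
    if r: "r \<in> carrier R" and x: "x \<in> carrier E" for r x
  proof -
    have "I +>\<^bsub>E\<^esub> (r \<odot>\<^bsub>E\<^esub> y) = I +>\<^bsub>E\<^esub> (r \<odot>\<^bsub>E\<^esub> x)" if y: "y \<in> I +>\<^bsub>E\<^esub> x" for y
    proof -
      obtain h where h: "h \<in> I" "y = h \<oplus>\<^bsub>E\<^esub> x" using y by (auto simp: a_r_coset_def')
      have rh: "r \<odot>\<^bsub>E\<^esub> h \<in> I" using ideal_smult_closed[OF I.ideal_axioms r h(1)] .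
      have "r \<odot>\<^bsub>E\<^esub> y \<ominus>\<^bsub>E\<^esub> r \<odot>\<^bsub>E\<^esub> x = r \<odot>\<^bsub>E\<^esub> h"
        using h r x rh ext_smult_closed[OF r x] I.Icarr
        by (simp add: ext_smult_r_distr E.minus_eq E.a_assoc E.r_neg)
      then show ?thesis
        using E.quotient_eq_iff_same_a_r_cos[OF I.ideal_axioms] h r x rh ext_smult_closed I.Icarr
        by (metis E.add.m_closed)
    qed
    \<comment> \<open>The union of equal cosets is that coset only because its index set is
      nonempty.\<close>
    moreover have "x \<in> I +>\<^bsub>E\<^esub> x" using x by (rule I.a_rcos_self)
    ultimately have "(\<Union>y\<in>I +>\<^bsub>E\<^esub> x. I +>\<^bsub>E\<^esub> (r \<odot>\<^bsub>E\<^esub> y)) = I +>\<^bsub>E\<^esub> (r \<odot>\<^bsub>E\<^esub> x)"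
      by blast
    then show ?thesis
      by (simp add: OS_algebra_def ring.extend_def module.fields_def I_def)
  qed
  \<comment> \<open>Adjoining scalar multiplication leaves the additive structure unchanged, so sums
    can be moved to \<open>E Quot I\<close>, where the ring lemmas apply.\<close>
  have fin: "finsum (OS_algebra R n \<C>) f A = finsum (E Quot I) f A" for f :: "nat \<Rightarrow> _" and A
    by (simp add: finsum_def finprod_def OS_algebra_def ring.extend_def module.fields_def I_def)
  have lin: "OS_linear R n \<C> \<xi> = I +>\<^bsub>E\<^esub> linear_form \<xi>" if \<xi>: "\<xi> \<in> {1..n} \<rightarrow> carrier R" for \<xi>
  proof -
    have gc: "ext_gen R n i \<in> carrier E" for i by (auto simp: ext_gen_def ext_simps)
    have t: "\<xi> i \<odot>\<^bsub>E\<^esub> ext_gen R n i \<in> carrier E" if "i \<in> {1..n}" for i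
      using that \<xi> gc by (intro ext_smult_closed) auto
    have "OS_linear R n \<C> \<xi> = (\<Oplus>\<^bsub>E Quot I\<^esub>i\<in>{1..n}. I +>\<^bsub>E\<^esub> (\<xi> i \<odot>\<^bsub>E\<^esub> ext_gen R n i))"
      unfolding OS_linear_def fin OS_gen_def I_def[symmetric]
      using \<xi> gc t by (intro Q.finsum_cong' refl) (auto intro!: smult)
    also have "\<dots> = I +>\<^bsub>E\<^esub> (\<Oplus>\<^bsub>E\<^esub>i\<in>{1..n}. \<xi> i \<odot>\<^bsub>E\<^esub> ext_gen R n i)"
      using t by (subst h.hom_finsum) (auto simp: comp_def)
    finally show ?thesis using linear_form_expand[OF \<xi>] by simp
  qed
  have "OS_linear R n \<C> \<alpha> \<otimes>\<^bsub>OS_algebra R n \<C>\<^esub> OS_linear R n \<C> \<beta> = I +>\<^bsub>E\<^esub> (linear_form \<alpha> \<otimes>\<^bsub>E\<^esub> linear_form \<beta>)"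
    unfolding lin[OF \<alpha>] lin[OF \<beta>]
    using \<alpha> \<beta> I.rcoset_mult_add[OF linear_form_closed linear_form_closed]
    by (simp add: OS_algebra_def ring.extend_def FactRing_def I_def)
  moreover have "\<zero>\<^bsub>OS_algebra R n \<C>\<^esub> = I"
    by (simp add: OS_algebra_def ring.extend_def FactRing_def I_def)
  moreover have "I +>\<^bsub>E\<^esub> x = I \<longleftrightarrow> x \<in> I" if "x \<in> carrier E" for x
    using I.rcos_const_imp_mem[OF that] E.a_rcos_zero[OF I.ideal_axioms] by blast
  ultimately show ?thesis
    using \<alpha> \<beta> by (simp add: I_def)
qed

end

section \<open>The three equivalent conditions and the annihilated minors\<close>

theorem theorem3p1:
  fixes R :: "('a, 'm) ring_scheme" (structure)
    and H :: "nat \<Rightarrow> (complex ^ 'l) set"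
    and n :: nat
    and lam eta :: "nat \<Rightarrow> 'a"
  defines "A \<equiv> OS_algebra R n (arrangement_circuits n H)"
    and "a \<equiv> OS_linear R n (arrangement_circuits n H)"
  assumes "cring R"
    and "hyperplane_arrangement n H"
    and "arrangement_rank n H = 2"
    and "lam \<in> {1..n} \<rightarrow>\<^sub>E carrier R" and "eta \<in> {1..n} \<rightarrow>\<^sub>E carrier R"
  shows "(a lam \<otimes>\<^bsub>A\<^esub> a eta = \<zero>\<^bsub>A\<^esub>
            \<longleftrightarrow> (\<forall>k\<in>{1..n}. coord_sum R lam {1..n} \<otimes> eta k \<ominus> coord_sum R eta {1..n} \<otimes> lam k = \<zero>))
       \<and> ((\<forall>k\<in>{1..n}. coord_sum R lam {1..n} \<otimes> eta k \<ominus> coord_sum R eta {1..n} \<otimes> lam k = \<zero>)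
            \<longleftrightarrow> (\<lambda>k\<in>{1..n}. coord_sum R lam {1..n} \<otimes> eta k) = (\<lambda>k\<in>{1..n}. coord_sum R eta {1..n} \<otimes> lam k))
       \<and> (a lam \<otimes>\<^bsub>A\<^esub> a eta = \<zero>\<^bsub>A\<^esub>
            \<longrightarrow> (\<forall>i\<in>{1..n}. \<forall>j\<in>{1..n}.
                   coord_sum R lam {1..n} \<otimes> (lam i \<otimes> eta j \<ominus> lam j \<otimes> eta i) = \<zero>
                 \<and> coord_sum R eta {1..n} \<otimes> (lam i \<otimes> eta j \<ominus> lam j \<otimes> eta i) = \<zero>))"
proof -
  interpret exterior R n by (rule exterior.intro) fact
  have circ: "arrangement_circuits n H = {C. C \<subseteq> {1..n} \<and> card C = 3}"
    using assms(4,5) by (rule arrangement_circuits_rank_two)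
  have lam: "lam \<in> {1..n} \<rightarrow> carrier R" and eta: "eta \<in> {1..n} \<rightarrow> carrier R"
    using assms(6,7) by (auto simp: PiE_iff)
  define L M where "L = coord_sum R lam {1..n}" and "M = coord_sum R eta {1..n}"
  have LM: "L \<in> carrier R" "M \<in> carrier R"
    using lam eta by (auto simp: L_def M_def coord_sum_def intro!: finsum_closed)
  have c: "lam k \<in> carrier R" "eta k \<in> carrier R" if "k \<in> {1..n}" for k
    using lam eta that by auto
  \<comment> \<open>Carrier membership of the generators comes along with their membership in
    \<open>boundary_kernel\<close>.\<close>
  have "ext_boundary R n ` {C. C \<subseteq> {1..n} \<and> card C = 3} \<subseteq> carrier E"
    using ext_boundary_triple_in_kernel by (auto elim!: card_3_orderedE simp: boundary_kernel_def)
  then have i_ii: "a lam \<otimes>\<^bsub>A\<^esub> a eta = \<zero>\<^bsub>A\<^esub> \<longleftrightarrow> (\<forall>k\<in>{1..n}. L \<otimes> eta k \<ominus> M \<otimes> lam k = \<zero>)"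
    unfolding A_def a_def circ L_def M_def
    by (simp only: OS_linear_mult_eq_zero_iff[OF _ lam eta] linear_form_mult_mem_iff[OF lam eta])
  have eq: "L \<otimes> eta k \<ominus> M \<otimes> lam k = \<zero> \<longleftrightarrow> L \<otimes> eta k = M \<otimes> lam k" if "k \<in> {1..n}" for k
    using c[OF that] LM by simp
  have ii_iii: "(\<forall>k\<in>{1..n}. L \<otimes> eta k \<ominus> M \<otimes> lam k = \<zero>)
      \<longleftrightarrow> (\<lambda>k\<in>{1..n}. L \<otimes> eta k) = (\<lambda>k\<in>{1..n}. M \<otimes> lam k)"
    (is "?ii \<longleftrightarrow> ?iii")
  proof
    show "?ii \<Longrightarrow> ?iii" by (intro restrict_ext) (use eq in blast)
    assume ?iii
    then have "L \<otimes> eta k = M \<otimes> lam k" if "k \<in> {1..n}" for k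
      using fun_cong[of _ _ k] restrict_apply'[OF that] by metis
    with eq show ?ii by blast
  qed
  have "L \<otimes> (lam i \<otimes> eta j \<ominus> lam j \<otimes> eta i) = \<zero> \<and> M \<otimes> (lam i \<otimes> eta j \<ominus> lam j \<otimes> eta i) = \<zero>"
    if ii: "\<forall>k\<in>{1..n}. L \<otimes> eta k \<ominus> M \<otimes> lam k = \<zero>" and ij: "i \<in> {1..n}" "j \<in> {1..n}" for i j
  proof -
    have e: "L \<otimes> eta i = M \<otimes> lam i" "L \<otimes> eta j = M \<otimes> lam j" using ii ij eq by auto
    note cc = c[OF ij(1)] c[OF ij(2)] LM
    \<comment> \<open>Attaching \<open>L\<close> to the entries of \<open>eta\<close> turns them
      into \<open>M\<close> times entries of \<open>lam\<close>, and the two terms coincide. For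
      \<open>M\<close> the roles are exchanged.\<close>
    have "L \<otimes> (lam i \<otimes> eta j \<ominus> lam j \<otimes> eta i) = lam i \<otimes> (L \<otimes> eta j) \<ominus> lam j \<otimes> (L \<otimes> eta i)"
      using cc by algebra
    also have "\<dots> = \<zero>" unfolding e using cc by algebra
    finally have "L \<otimes> (lam i \<otimes> eta j \<ominus> lam j \<otimes> eta i) = \<zero>" .
    moreover have "M \<otimes> (lam i \<otimes> eta j \<ominus> lam j \<otimes> eta i) = (M \<otimes> lam i) \<otimes> eta j \<ominus> (M \<otimes> lam j) \<otimes> eta i"
      using cc by algebra
    moreover have "\<dots> = \<zero>" unfolding e[symmetric] using cc by algebra
    ultimately show ?thesis by simp
  qed
  then show ?thesis
    using i_ii ii_iii unfolding L_def M_def by blast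
qed

end
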